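(* Let $n\geq 3$, let $d\neq n$ be a positive divisor of $n$, let $G=\langle a\rangle\cong\mathbb{Z}_n$ be a cyclic group of order $n$ (written multiplicatively), and let $A=\mathrm{Aut}(G)$. Let $T_d=\{\sigma\in A\mid g^\sigma=g \text{ for all } g\in[a^d]\}$ and let $K_d$ be a subgroup of $A$ containing $T_d$. For a fixed integer $1\leq k\leq n-1$ with $\gcd(k,n)=d$, put $S_{k,d}=\{(a^k)^\sigma\mid \sigma\in K_d\}$ and $\Gamma_{k,d}=\mathrm{Cay}(G,S_{k,d})$. Then: (1) $S_{k,d}$ is inverse-closed if $K_d$ contains the element $\tau$ of $A$ which maps $a$ to $a^{-1}$. (2) $|S_{k,d}|=|K_d:T_d|\leq \varphi(n/d)$. (3) $S_{k,d}$ is a generating set of $G$ if and only if $d=1$. In this case, $T_1=\{1_A\}$. (4) $\deg(\Gamma_{k,d})$ is a divisor of $|A:K_d|$. (5) $\Gamma_{k,d}$ is integral if and only if $A=K_d$. In this case, $S_{k,d}=[a^d]$. In particular, if $|A:K_d|=p$ for some prime $p$, then $\Gamma_{k,d}$ is $p$-integral.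
   Context: For a finite group $G$ and a subset $S\subseteq G$, $\mathrm{Cay}(G,S)$ is the (di)graph with vertex set $G$ in which $(g,h)$ is an arc if and only if $hg^{-1}\in S$ ($S$ need not be inverse-closed). For a (di)graph $\Gamma$, $\mathbb{SF}(\Gamma)$ is the smallest extension of $\mathbb{Q}$ containing all eigenvalues of the adjacency matrix of $\Gamma$, and $\deg(\Gamma)=[\mathbb{SF}(\Gamma):\mathbb{Q}]$ is its algebraic degree. $\Gamma$ is $k$-integral if $\deg(\Gamma)=k$, and integral if all its eigenvalues are integers (equivalently, $\deg(\Gamma)=1$). For $g\in G$, $[g]=\{h\in G\mid \langle h\rangle=\langle g\rangle\}$. For $\sigma\in\mathrm{Aut}(G)$, $g^\sigma$ is the image of $g$ under $\sigma$. $\varphi$ is Euler's function. *)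

theory Defs
  imports
    "HOL-Algebra.Bij"
    "HOL-Algebra.Generated_Groups"
    "HOL-Algebra.Generated_Fields"
    "HOL-Algebra.Embedded_Algebras"
    "HOL-Algebra.Algebraic_Closure_Type"
    "HOL-Number_Theory.Totient"
    "Graph_Theory.Pair_Digraph"
    "Jordan_Normal_Form.Char_Poly"
begin

definition subgroup_index :: "('a, 'b) monoid_scheme \<Rightarrow> 'a set \<Rightarrow> nat" where
  "subgroup_index G H = card (rcosets\<^bsub>G\<^esub> H)"

text \<open>The class \<open>[g]\<close> of all elements generating the same cyclic subgroup as \<open>g\<close>.\<close>

definition same_generated :: "('a, 'b) monoid_scheme \<Rightarrow> 'a \<Rightarrow> 'a set" where
  "same_generated G g = {h \<in> carrier G. generate G {h} = generate G {g}}"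

definition aut_fixing :: "('a, 'b) monoid_scheme \<Rightarrow> 'a set \<Rightarrow> ('a \<Rightarrow> 'a) set" where
  "aut_fixing G Y = {\<sigma> \<in> carrier (AutoGroup G). \<forall>g\<in>Y. \<sigma> g = g}"

definition inverse_closed :: "('a, 'b) monoid_scheme \<Rightarrow> 'a set \<Rightarrow> bool" where
  "inverse_closed G S \<longleftrightarrow> (\<forall>s\<in>S. inv\<^bsub>G\<^esub> s \<in> S)"

definition Cay :: "('a, 'b) monoid_scheme \<Rightarrow> 'a set \<Rightarrow> 'a pair_pre_digraph" where
  "Cay G S = \<lparr> pverts = carrier G,
     parcs = {(g, h). g \<in> carrier G \<and> h \<in> carrier G \<and> h \<otimes>\<^bsub>G\<^esub> inv\<^bsub>G\<^esub> g \<in> S} \<rparr>"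

definition adjacency_matrix :: "'v list \<Rightarrow> 'v pair_pre_digraph \<Rightarrow> complex mat" where
  "adjacency_matrix vs \<Gamma> = Matrix.mat (length vs) (length vs)
     (\<lambda>(i, j). if (vs ! i, vs ! j) \<in> parcs \<Gamma> then 1 else 0)"

text \<open>Different enumerations \<open>vs\<close> of the vertices give permutation-similar adjacency
  matrices, so the eigenvalues do not depend on the enumeration.\<close>

definition graph_eigenvalues :: "'v pair_pre_digraph \<Rightarrow> complex set" where
  "graph_eigenvalues \<Gamma> = {x. \<exists>vs. distinct vs \<and> set vs = pverts \<Gamma> \<and>
     eigenvalue (adjacency_matrix vs \<Gamma>) x}"

definition splitting_field :: "'v pair_pre_digraph \<Rightarrow> complex set" where
  "splitting_field \<Gamma> =
     generate_field (ring_of_type_algebra :: complex ring) (\<rat> \<union> graph_eigenvalues \<Gamma>)"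

definition algebraic_degree :: "'v pair_pre_digraph \<Rightarrow> nat" where
  "algebraic_degree \<Gamma> = ring.dim (ring_of_type_algebra :: complex ring) \<rat> (splitting_field \<Gamma>)"

definition k_integral :: "nat \<Rightarrow> 'v pair_pre_digraph \<Rightarrow> bool" where
  "k_integral k \<Gamma> \<longleftrightarrow> algebraic_degree \<Gamma> = k"

definition integral_graph :: "'v pair_pre_digraph \<Rightarrow> bool" where
  "integral_graph \<Gamma> \<longleftrightarrow> graph_eigenvalues \<Gamma> \<subseteq> \<int>"

end

theory Submission
  imports Defs "HOL-Number_Theory.Number_Theory"
begin

text \<open>Let \<open>w\<close> be a primitive \<open>n\<close>-th root of unity. The eigenvalues of \<open>\<Gamma>\<close> are the character sums
  of \<open>S\<close>. Raising \<open>w\<close> to the power \<open>s\<close>, for \<open>s\<close> coprime to \<open>n\<close>, sends the character sums of \<open>S\<close>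
  to those of the translate of \<open>S\<close> by the automorphism \<open>g \<mapsto> g ^ s\<close>. By Fourier inversion all
  eigenvalues are fixed by \<open>s\<close> if and only if the translate is \<open>S\<close> itself, which, since \<open>K\<close> contains
  the stabilizer \<open>T\<close>, means that the automorphism lies in \<open>K\<close>. Hence the algebraic degree is not
  only a divisor of the index of \<open>K\<close> but equal to it. The field degree is computed from a
  primitive element \<open>\<theta>\<close>, a combination of the eigenvalues whose conjugates separate the translates
  of \<open>S\<close>: its powers are independent because cyclotomic polynomials are irreducible, and they
  span the field by Lagrange interpolation at the conjugates of \<open>\<theta>\<close>.\<close>

section \<open>Integer polynomials at roots of unity\<close>

text \<open>No field automorphism is ever constructed. A number is carried together with all its
  conjugates, as a function of the exponent \<open>s\<close>, and the only Galois-theoretic input is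
  that an equation true at one \<open>s\<close> coprime to \<open>n\<close> is true at all of them.
  The final claim on integrality is the reason for starting from integer polynomials: an invariant
  element of \<int>[w] is an integer, while rational polynomials would only give a rational number.
  Denominators enter when inverses are needed, for the field operations and for interpolation. The
  subgroup \<open>K\<close> must contain the stabilizer for a translate of \<open>S\<close> to
  remember its coset. The automorphism group is abelian, so two automorphisms with the same
  translate have a quotient that differs from an element of \<open>K\<close> by an automorphism
  fixing the base point of the orbit, and such automorphisms lie in \<open>K\<close>. The count of
  conjugate tuples of eigenvalues thus becomes a count of cosets.\<close>

abbreviation int_eval :: "int poly \<Rightarrow> complex \<Rightarrow> complex" where
  "int_eval f x \<equiv> poly (map_poly of_int f) x"

declare poly_monom [simp]

lemma int_eval_simps [simp]:
  "int_eval (f + g) x = int_eval f x + int_eval g x"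
  "int_eval (f - g) x = int_eval f x - int_eval g x"
  "int_eval (f * g) x = int_eval f x * int_eval g x"
  "int_eval (f ^ k) x = int_eval f x ^ k"
  "int_eval (smult c f) x = of_int c * int_eval f x"
  "int_eval (pCons c f) x = of_int c + x * int_eval f x"
  by (simp_all add: of_int_poly_hom.hom_add of_int_poly_hom.hom_minus of_int_poly_hom.hom_mult
      of_int_poly_hom.hom_power of_int_hom.map_poly_hom_smult of_int_hom.map_poly_pCons_hom
      poly_monom)

lemma int_eval_of_nat [simp]: "int_eval (of_nat k) x = of_nat k"
  by (induction k) simp_all

lemma int_eval_unity_poly: "int_eval (monom 1 n - 1) x = x ^ n - 1"
  by (simp add: poly_monom)

lemma unity_poly_nonzero:
  assumes "n > 0"
  shows "monom 1 n - 1 \<noteq> (0 :: 'a :: comm_ring_1 poly)"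
proof -
  have "poly.coeff (monom 1 n - 1 :: 'a poly) n = 1"
    using assms by simp
  then show ?thesis by force
qed

lemma degree_unity_poly:
  assumes "n > 0"
  shows "Polynomial.degree (monom 1 n - 1 :: int poly) = n"
  using assms
  by (subst diff_conv_add_uminus, subst degree_add_eq_left) (auto simp: degree_monom_eq)

text \<open>Leading coefficients multiply, so that of a factor is a unit of \<int>. Its square is
  stated because scaling \<open>q\<close> by its own leading coefficient then makes it
  monic.\<close>

lemma lead_coeff_dvd_monic:
  fixes q f :: "int poly"
  assumes "q dvd f" and "lead_coeff f = 1"
  shows "lead_coeff q * lead_coeff q = 1"
proof -
  obtain h where "f = q * h" using assms(1) by blast
  then have "lead_coeff q * lead_coeff h = 1"
    using assms(2) by (simp add: lead_coeff_mult)
  then show ?thesis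
    by (smt (verit) zmult_eq_1_iff)
qed

text \<open>This is Gauss's lemma: an integer polynomial of least degree vanishing at
  \<open>w\<close>, made primitive, divides a nonzero integer multiple of every other one by
  pseudo-division, and primitivity cancels the multiplier. Since it divides
  \<open>X ^ n - 1\<close>, its leading coefficient is a unit, and a change of sign makes it
  monic.\<close>

lemma minimal_polynomial_root_of_unity:
  fixes w :: complex
  assumes n: "n > 0" and w: "w ^ n = 1"
  obtains q :: "int poly"
  where "lead_coeff q = 1" and "Polynomial.degree q > 0" and "\<And>f. int_eval f w = 0 \<longleftrightarrow> q dvd f"
proof -
  have X: "monom 1 n - 1 \<noteq> (0 :: int poly)" "int_eval (monom 1 n - 1) w = 0"
    using unity_poly_nonzero[OF n] w by (auto simp: int_eval_unity_poly simp del: int_eval_simps)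
  obtain q0 :: "int poly" where q0: "q0 \<noteq> 0" "int_eval q0 w = 0"
    and min0: "\<And>f. f \<noteq> 0 \<Longrightarrow> int_eval f w = 0 \<Longrightarrow> Polynomial.degree q0 \<le> Polynomial.degree f"
    using ex_has_least_nat[of "\<lambda>f. f \<noteq> 0 \<and> int_eval f w = 0" "monom 1 n - 1" Polynomial.degree] X
    by blast
  define q1 where "q1 = primitive_part q0"
  have q1_eq: "q0 = smult (content q0) q1" by (simp add: q1_def)
  have q1: "q1 \<noteq> 0" "content q1 = 1" using q0 by (auto simp: q1_def)
  have "int_eval q0 w = of_int (content q0) * int_eval q1 w"
    by (subst q1_eq) simp
  then have ev1: "int_eval q1 w = 0" using q0 by simp
  have deg1: "Polynomial.degree q1 = Polynomial.degree q0" by (simp add: q1_def)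
  have dvd1: "q1 dvd f" if f: "int_eval f w = 0" for f
  proof -
    obtain a b where a: "a \<noteq> 0" and ab: "smult a f = q1 * b + pseudo_mod f q1"
      using pseudo_mod(1)[OF q1(1), of f] by blast
    have "int_eval (smult a f) w = 0" using f by simp
    then have "int_eval (pseudo_mod f q1) w = 0"
      using ev1 unfolding ab by simp
    then have "pseudo_mod f q1 = 0"
      using pseudo_mod(2)[OF q1(1), of f] min0 deg1 by (metis not_less)
    then have ab: "smult a f = q1 * b" using ab by simp
    then have "content b = normalize a * content f"
      by (metis content_mult content_smult mult_1 q1(2))
    then have "a dvd content b" by simp
    then have "[:a:] dvd b" by (simp add: const_poly_dvd_iff_dvd_content)
    then obtain b' where "b = [:a:] * b'" by blast
    then have "smult a f = smult a (q1 * b')" using ab by simp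
    then have "f = q1 * b'" using a by (simp add: smult_cancel)
    then show ?thesis by simp
  qed
  have lc: "lead_coeff (monom 1 n - 1 :: int poly) = 1"
    using degree_unity_poly[OF n] n by simp
  have u: "lead_coeff q1 * lead_coeff q1 = 1"
    using lead_coeff_dvd_monic[OF dvd1[OF X(2)] lc] .
  define q where "q = smult (lead_coeff q1) q1"
  have "lead_coeff q = 1" using u q1(1) by (simp add: q_def)
  moreover have "int_eval f w = 0 \<longleftrightarrow> q dvd f" for f
  proof
    assume "int_eval f w = 0"
    then obtain b where b: "f = q1 * b" using dvd1 by blast
    have "q * smult (lead_coeff q1) b = smult (lead_coeff q1 * lead_coeff q1) (q1 * b)"
      by (simp add: q_def)
    then have "f = q * smult (lead_coeff q1) b" using b u by (simp only: smult_1_left)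
    then show "q dvd f" using dvd_triv_left by blast
  next
    assume "q dvd f"
    then obtain h where "f = q * h" by blast
    then have "f = q1 * smult (lead_coeff q1) h" by (simp add: q_def)
    then show "int_eval f w = 0" using ev1 by simp
  qed
  moreover have "Polynomial.degree q > 0"
  proof (rule ccontr)
    assume "\<not> Polynomial.degree q > 0"
    then obtain c where c: "q = [:c:]" by (meson degree_eq_zeroE neq0_conv)
    then have "c = 1" using \<open>lead_coeff q = 1\<close> by simp
    then have "q = 1" using c by (simp add: one_pCons)
    then have "q dvd 1" by simp
    then have "int_eval 1 w = 0" using calculation(2) by blast
    then show False by simp
  qed
  ultimately show ?thesis using that by blast
qed

text \<open>The inner binomial coefficients are multiples of \<open>p\<close>. The ring is general
  because the congruence serves both in \<int>, for Fermat's little theorem, and in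
  \<int>[X].\<close>

lemma prime_dvd_add_power_diff:
  fixes x y :: "'a :: comm_ring_1"
  assumes p: "Factorial_Ring.prime p"
  shows "of_nat p dvd (x + y) ^ p - x ^ p - y ^ p"
proof -
  have p1: "p \<ge> 1" using prime_ge_1_nat[OF p] .
  have set: "{..p} = insert 0 (insert p {1..<p})" using p1 by auto
  have "(x + y) ^ p = (\<Sum>k\<le>p. of_nat (p choose k) * x ^ k * y ^ (p - k))"
    by (rule binomial_ring)
  also have "\<dots> = y ^ p + x ^ p + (\<Sum>k\<in>{1..<p}. of_nat (p choose k) * x ^ k * y ^ (p - k))"
    unfolding set using p1 by (subst sum.insert) (auto simp: add.assoc)
  finally have eq: "(x + y) ^ p - x ^ p - y ^ p = (\<Sum>k\<in>{1..<p}. of_nat (p choose k) * x ^ k * y ^ (p - k))"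
    by simp
  have "p dvd (p choose k)" if "k \<in> {1..<p}" for k
    using that p by (intro dvd_choose_prime) auto
  then have "of_nat p dvd (of_nat (p choose k) :: 'a)" if "k \<in> {1..<p}" for k
    using that by (metis dvd_def of_nat_mult)
  then show ?thesis unfolding eq by (intro dvd_sum) (auto intro!: dvd_mult2)
qed

text \<open>Fermat's little theorem: by the preceding congruence with one summand equal to 1,
  \<open>a - a ^ p\<close> does not change modulo \<open>p\<close> when \<open>a\<close> moves by
  one, in either direction.\<close>

lemma prime_dvd_power_diff_int:
  fixes a :: int
  assumes p: "Factorial_Ring.prime p"
  shows "int p dvd a - a ^ p"
proof (induction a rule: int_induct[where k = 0])
  case base
  then show ?case using prime_gt_0_nat[OF p] by (simp add: power_0_left)
next
  case (step1 i)
  have "(i + 1) - (i + 1) ^ p = (i - i ^ p) - ((i + 1) ^ p - i ^ p - 1 ^ p)" by simp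
  then show ?case using step1 prime_dvd_add_power_diff[OF p, of i 1] by (metis dvd_diff)
next
  case (step2 i)
  have "(i - 1) - (i - 1) ^ p = (i - i ^ p) + (((i - 1) + 1) ^ p - (i - 1) ^ p - 1 ^ p)" by simp
  then show ?case using step2 prime_dvd_add_power_diff[OF p, of "i - 1" 1] by (metis dvd_add)
qed

text \<open>Induction on the coefficients: Fermat's theorem handles the constant term, and the
  binomial congruence splits the \<open>p\<close>-th power of the sum. The error is kept as
  \<open>p\<close> times an integer polynomial in \<open>x\<close>, since divisibility by
  \<open>p\<close> among complex numbers would say nothing.\<close>

lemma frobenius_int_eval:
  assumes p: "Factorial_Ring.prime p"
  shows "\<exists>g. int_eval f (x ^ p) = int_eval f x ^ p + of_nat p * int_eval g x"
proof (induction f)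
  case 0
  show ?case using prime_gt_0_nat[OF p] by (intro exI[of _ 0]) simp
next
  case (pCons a f)
  obtain g where g: "int_eval f (x ^ p) = int_eval f x ^ p + of_nat p * int_eval g x"
    using pCons by blast
  obtain b where b: "a - a ^ p = int p * b" using prime_dvd_power_diff_int[OF p] by blast
  obtain h :: "int poly" where h: "([:a:] + monom 1 1 * f) ^ p - [:a:] ^ p - (monom 1 1 * f) ^ p = of_nat p * h"
    using prime_dvd_add_power_diff[OF p] by blast
  have h': "(of_int a + x * int_eval f x) ^ p - of_int a ^ p - (x * int_eval f x) ^ p = of_nat p * int_eval h x"
    using arg_cong[OF h, of "\<lambda>f. int_eval f x"]
    by simp
  have b': "of_int a - of_int a ^ p = (of_nat p * of_int b :: complex)"
    using arg_cong[OF b, of "of_int :: int \<Rightarrow> complex"] by simp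
  have "int_eval (pCons a f) (x ^ p) = of_int a + x ^ p * (int_eval f x ^ p + of_nat p * int_eval g x)"
    by (simp add: g)
  also have "\<dots> = (of_int a - of_int a ^ p) + (of_int a ^ p + (x * int_eval f x) ^ p) + of_nat p * (x ^ p * int_eval g x)"
    by (simp add: algebra_simps power_mult_distrib)
  also have "\<dots> = (of_int a + x * int_eval f x) ^ p + of_nat p * (of_int b - int_eval h x + x ^ p * int_eval g x)"
    using h' b' by (simp add: algebra_simps)
  also have "\<dots> = int_eval (pCons a f) x ^ p + of_nat p * int_eval ([:b:] - h + monom 1 p * g) x"
    by simp
  finally show ?case by blast
qed


text \<open>Pseudo-division scales the dividend by a power of the leading coefficient of
  \<open>q\<close>, which is 1 here.\<close>

lemma monic_int_division:
  fixes f q :: "int poly"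
  assumes "lead_coeff q = 1"
  obtains b r where "f = q * b + r" and "r = 0 \<or> Polynomial.degree r < Polynomial.degree q"
proof -
  have "q \<noteq> 0" using assms by auto
  obtain b r where br: "pseudo_divmod f q = (b, r)" by fastforce
  show ?thesis
    using pseudo_divmod[OF \<open>q \<noteq> 0\<close> br] assms that by simp
qed

text \<open>Write \<open>X ^ n - 1 = q h\<close> with \<open>q\<close> minimal. If \<open>w ^ p\<close> were not a root of \<open>q\<close>, it would be a root of
  \<open>h\<close>, and differentiating gives \<open>n = q(w ^ p) h'(w ^ p) w ^ p\<close>. As \<open>q(w ^ p)\<close> is congruent to
  \<open>q(w) ^ p = 0\<close> modulo \<open>p\<close>, this forces \<open>p\<close> to divide \<open>n\<close>.\<close>

lemma int_eval_root_prime_power: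
  fixes w :: complex
  assumes n: "n > 0" and w: "w ^ n = 1" and p: "Factorial_Ring.prime p" "\<not> p dvd n"
    and f: "int_eval f w = 0"
  shows "int_eval f (w ^ p) = 0"
proof -
  obtain q where q: "lead_coeff q = 1" "Polynomial.degree q > 0"
    and min: "\<And>f. int_eval f w = 0 \<longleftrightarrow> q dvd f"
    using minimal_polynomial_root_of_unity[OF n w] by blast
  have "int_eval (monom 1 n - 1) w = 0" using w by simp
  then have "q dvd monom 1 n - 1" by (rule min[THEN iffD1])
  then obtain h where h: "monom 1 n - 1 = q * h" by blast
  have "int_eval q (w ^ p) = 0"
  proof (rule ccontr)
    assume nz: "int_eval q (w ^ p) \<noteq> 0"
    have wp: "(w ^ p) ^ n = 1" using w by (metis power_mult mult.commute power_one)
    have "int_eval q (w ^ p) * int_eval h (w ^ p) = 0"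
      using arg_cong[OF h, of "\<lambda>f. int_eval f (w ^ p)"] wp by simp
    then have hz: "int_eval h (w ^ p) = 0" using nz by simp
    have "int_eval (pderiv (monom 1 n - 1)) (w ^ p) = int_eval q (w ^ p) * int_eval (pderiv h) (w ^ p)"
      unfolding h pderiv_mult using hz by simp
    moreover have "pderiv (monom 1 n - 1 :: int poly) = monom (int n) (n - 1)"
      by (simp add: pderiv_diff pderiv_monom)
    ultimately have "of_nat n * (w ^ p) ^ (n - 1) = int_eval q (w ^ p) * int_eval (pderiv h) (w ^ p)"
      by simp
    then have "of_nat n * ((w ^ p) ^ (n - 1) * w ^ p) = int_eval q (w ^ p) * int_eval (pderiv h) (w ^ p) * w ^ p"
      by (simp only: mult.assoc[symmetric])
    moreover have "(w ^ p) ^ (n - 1) * w ^ p = 1"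
      using wp n by (metis power_minus_mult)
    ultimately have n_eq: "of_nat n = int_eval q (w ^ p) * int_eval (pderiv h) (w ^ p) * w ^ p"
      by (simp only: mult_1_right)
    obtain g where g: "int_eval q (w ^ p) = int_eval q w ^ p + of_nat p * int_eval g w"
      using frobenius_int_eval[OF p(1)] by blast
    have "int_eval q w = 0" by (rule min[THEN iffD2]) simp
    then have g: "int_eval q (w ^ p) = of_nat p * int_eval g w"
      using g prime_gt_0_nat[OF p(1)] by simp
    \<comment> \<open>\<open>G(w)\<close> is \<open>n / p\<close>. Substituting \<open>X ^ p\<close>
      turns the values at \<open>w ^ p\<close> into values at \<open>w\<close>, so that reduction
      modulo \<open>q\<close> becomes available.\<close>
    define G where "G = g * pcompose (pderiv h) (monom 1 p) * monom 1 p"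
    have "int_eval (pcompose (pderiv h) (monom 1 p)) w = int_eval (pderiv h) (w ^ p)"
      by (simp add: of_int_hom.map_poly_pcompose poly_pcompose poly_monom)
    then have nG: "of_nat n = of_nat p * int_eval G w"
      using n_eq g by (simp add: G_def)
    obtain b r where br: "G = q * b + r" "r = 0 \<or> Polynomial.degree r < Polynomial.degree q"
      using monic_int_division[OF q(1)] by blast
    have "int_eval (smult (int p) r - [:int n:]) w = 0"
      using nG \<open>int_eval q w = 0\<close> by (simp add: br(1))
    then have dv: "q dvd smult (int p) r - [:int n:]" by (rule min[THEN iffD1])
    \<comment> \<open>Below the degree of \<open>q\<close> only the zero polynomial vanishes at
      \<open>w\<close>. Hence \<open>p r = n\<close> as polynomials, and the constant coefficient
      shows that \<open>p\<close> divides \<open>n\<close>.\<close>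
    have "Polynomial.degree (smult (int p) r - [:int n:]) < Polynomial.degree q"
      using br(2) q(2) by (intro degree_diff_less) auto
    then have "smult (int p) r - [:int n:] = 0"
      using dv by (meson dvd_imp_degree_le not_less)
    then have "poly.coeff (smult (int p) r - [:int n:]) 0 = 0" by simp
    then have "int n = int p * poly.coeff r 0" by simp
    then have "p dvd n" by (metis dvd_triv_left int_dvd_int_iff)
    then show False using p by blast
  qed
  moreover have "q dvd f" using f by (rule min[THEN iffD1])
  then obtain k where "f = q * k" by blast
  ultimately show ?thesis by simp
qed

text \<open>The Galois group of the cyclotomic field acts on it by \<open>w \<mapsto> w ^ t\<close>; in this form the
  irreducibility of the cyclotomic polynomials enters.\<close>

lemma int_eval_root_coprime_power:
  fixes w :: complex
  assumes n: "n > 0" and w: "w ^ n = 1" and t: "coprime t n" and f: "int_eval f w = 0"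
  shows "int_eval f (w ^ t) = 0"
  using t
proof (induction t rule: less_induct)
  case (less t)
  consider "t = 0" | "t = 1" | "t > 1" by linarith
  then show ?case
  proof cases
    case 1
    then have "n = 1" using less.prems by simp
    then show ?thesis using 1 w f by simp
  next
    case 2
    then show ?thesis using f by simp
  next
    case 3
    then obtain p where p: "Factorial_Ring.prime p" "p dvd t"
      using prime_factor_nat[of t] by auto
    then obtain s where s: "t = p * s" by blast
    have "s < t" using s 3 prime_gt_1_nat[OF p(1)] by (cases "s = 0") auto
    moreover have cop: "coprime s n" "coprime p n" using less.prems s by auto
    ultimately have "int_eval f (w ^ s) = 0" using less.IH by blast
    moreover have "\<not> p dvd n"
      using cop(2) p(1) by (metis coprime_absorb_left not_prime_unit)
    \<comment> \<open>Each prime is applied to the root of unity \<open>w ^ s\<close> reached so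
      far, which is why the prime case is available for every \<open>n\<close>-th root of
      unity.\<close>
    moreover have "(w ^ s) ^ n = 1" using w by (metis power_mult mult.commute power_one)
    ultimately have "int_eval f ((w ^ s) ^ p) = 0"
      using int_eval_root_prime_power[OF n _ p(1)] by blast
    then show ?thesis by (simp add: s power_mult[symmetric] mult.commute)
  qed
qed

section \<open>Families of conjugates in a cyclotomic field\<close>

locale primitive_root_of_unity =
  fixes n :: nat and w :: complex
  assumes n_gt_1: "n > 1"
    and power_eq_1_iff: "\<And>i. w ^ i = 1 \<longleftrightarrow> n dvd i"
begin

lemma n_pos: "n > 0"
  using n_gt_1 by simp

lemma power_n: "w ^ n = 1"
  by (simp add: power_eq_1_iff)

lemma nonzero: "w \<noteq> 0"
  using power_n n_pos by (metis zero_neq_one zero_power)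

lemma power_eq_iff: "w ^ i = w ^ j \<longleftrightarrow> [i = j] (mod n)"
proof -
  have *: "w ^ i = w ^ j \<longleftrightarrow> [i = j] (mod n)" if "i \<le> j" for i j
  proof -
    have "w ^ j = w ^ i * w ^ (j - i)" using that by (metis le_add_diff_inverse power_add)
    then have "w ^ i = w ^ j \<longleftrightarrow> w ^ (j - i) = 1" using nonzero by auto
    also have "\<dots> \<longleftrightarrow> [j = i] (mod n)" using that by (simp add: power_eq_1_iff cong_altdef_nat)
    finally show ?thesis by (simp add: cong_sym_eq)
  qed
  show ?thesis
    using *[of i j] *[of j i] by (metis cong_sym_eq nat_le_linear)
qed

lemma power_power_eq_1: "(w ^ i) ^ n = 1"
  by (metis power_n mult.commute power_mult power_one)

lemma roots_of_unity_eq: "{x. x ^ n = 1} = (\<lambda>i. w ^ i) ` {..<n}"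
proof -
  have "inj_on (\<lambda>i. w ^ i) {..<n}"
    by (auto simp: inj_on_def power_eq_iff cong_less_modulus_unique_nat)
  then have "card ((\<lambda>i. w ^ i) ` {..<n}) = n" by (simp add: card_image)
  moreover have "card {x :: complex. x ^ n = 1} = n"
    using card_roots_unity_eq[of n] n_pos by simp
  moreover have "(\<lambda>i. w ^ i) ` {..<n} \<subseteq> {x. x ^ n = 1}"
    using power_power_eq_1 by auto
  ultimately show ?thesis
    by (metis card_subset_eq card_ge_0_finite n_pos)
qed

text \<open>Every root \<open>x\<close> of \<open>q\<close> is a root of unity \<open>w ^ i\<close>,
  whose minimal polynomial \<open>r\<close> divides \<open>q\<close>. Minimality of \<open>q\<close>
  makes \<open>w\<close> a root of \<open>r\<close>, hence of \<open>X ^ m - 1\<close> with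
  \<open>m = n / gcd i n\<close>, so that \<open>n\<close> divides \<open>m\<close> and the gcd is
  1.\<close>

lemma minimal_polynomial_roots:
  assumes q: "\<And>f. int_eval f w = 0 \<longleftrightarrow> q dvd f" "lead_coeff q = 1" and x: "int_eval q x = 0"
  shows "\<exists>s. coprime s n \<and> x = w ^ s"
proof -
  have "q dvd monom 1 n - 1"
    using power_n by (intro q(1)[THEN iffD1]) simp
  then obtain h0 where h0: "monom 1 n - 1 = q * h0" by blast
  have "int_eval (monom 1 n - 1) x = 0" unfolding h0 using x by simp
  then have "x \<in> {x. x ^ n = 1}" by simp
  then obtain i where i: "i < n" "x = w ^ i" unfolding roots_of_unity_eq by auto
  define e where "e = gcd i n"
  define m where "m = n div e"
  have e: "e dvd n" "e dvd i" "e > 0" using n_pos by (auto simp: e_def)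
  have m: "n = m * e" "m > 0" using e n_pos by (auto simp: m_def)
  have "x ^ m = w ^ (i * m)" by (simp add: i power_mult)
  moreover have "n dvd i * m"
    using e(2) m(1) by (auto elim!: dvdE)
  ultimately have xm: "x ^ m = 1" by (simp add: power_eq_1_iff)
  obtain r where r: "lead_coeff r = 1" "Polynomial.degree r > 0"
    and min: "\<And>f. int_eval f x = 0 \<longleftrightarrow> r dvd f"
    using minimal_polynomial_root_of_unity[OF m(2) xm] by blast
  have "r dvd q" using x by (rule min[THEN iffD1])
  then obtain h where h: "q = r * h" by blast
  have "r dvd monom 1 m - 1" using xm by (intro min[THEN iffD1]) simp
  then obtain k where k: "monom 1 m - 1 = r * k" by blast
  have "int_eval q w = 0" by (rule q(1)[THEN iffD2]) simp
  then have "int_eval r w = 0 \<or> int_eval h w = 0" by (simp add: h)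
  \<comment> \<open>The cofactor has smaller degree than \<open>q\<close>, which divides every
    integer polynomial vanishing at \<open>w\<close>.\<close>
  moreover have "int_eval h w \<noteq> 0"
  proof
    assume "int_eval h w = 0"
    then have "q dvd h" by (rule q(1)[THEN iffD1])
    moreover have "h \<noteq> 0" "r \<noteq> 0" using q(2) h by auto
    ultimately have "Polynomial.degree q \<le> Polynomial.degree h" by (simp add: dvd_imp_degree_le)
    moreover have "Polynomial.degree q = Polynomial.degree r + Polynomial.degree h"
      using \<open>h \<noteq> 0\<close> \<open>r \<noteq> 0\<close> by (simp add: h degree_mult_eq)
    ultimately show False using r(2) by simp
  qed
  ultimately have "int_eval (monom 1 m - 1) w = 0" unfolding k by simp
  then have "n dvd m" by (simp add: power_eq_1_iff)
  then have "n \<le> m" using m(2) by (rule dvd_imp_le)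
  then have "m * e \<le> m" using m(1) by simp
  then have "e = 1" using m(2) e(3) by (cases e) auto
  then have "coprime i n" unfolding e_def by (rule gcd_eq_1_imp_coprime)
  then show ?thesis using i by blast
qed

text \<open>An element \<open>f(w)\<close> of the ring \<open>\<int>[w]\<close> is represented by the family of its conjugates \<open>f(w ^ s)\<close>;
  the values at \<open>s\<close> not coprime to \<open>n\<close> are irrelevant. Rational families do the same for the
  cyclotomic field.\<close>

definition int_family :: "(nat \<Rightarrow> complex) \<Rightarrow> bool" where
  "int_family c \<longleftrightarrow> (\<exists>f. \<forall>s. coprime s n \<longrightarrow> c s = int_eval f (w ^ s))"

lemma int_familyE:
  assumes "int_family c"
  obtains f where "\<And>s. coprime s n \<Longrightarrow> c s = int_eval f (w ^ s)"
  using assms unfolding int_family_def by blast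

lemma int_familyI:
  assumes "\<And>s. coprime s n \<Longrightarrow> c s = int_eval f (w ^ s)"
  shows "int_family c"
  using assms unfolding int_family_def by blast

lemma int_family_const: "int_family (\<lambda>s. of_int k)"
  by (rule int_familyI[of _ "[:k:]"]) simp

lemma int_family_power: "int_family (\<lambda>s. w ^ (j * s))"
  by (rule int_familyI[of _ "monom 1 j"]) (simp add: power_mult[symmetric] mult.commute)

lemma int_family_add:
  assumes "int_family b" "int_family c"
  shows "int_family (\<lambda>s. b s + c s)"
proof -
  obtain f g where "\<And>s. coprime s n \<Longrightarrow> b s = int_eval f (w ^ s)" "\<And>s. coprime s n \<Longrightarrow> c s = int_eval g (w ^ s)"
    using assms by (metis int_familyE)
  then show ?thesis by (intro int_familyI[of _ "f + g"]) simp
qed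

lemma int_family_mult:
  assumes "int_family b" "int_family c"
  shows "int_family (\<lambda>s. b s * c s)"
proof -
  obtain f g where "\<And>s. coprime s n \<Longrightarrow> b s = int_eval f (w ^ s)" "\<And>s. coprime s n \<Longrightarrow> c s = int_eval g (w ^ s)"
    using assms by (metis int_familyE)
  then show ?thesis by (intro int_familyI[of _ "f * g"]) simp
qed

lemma int_family_sum:
  assumes "\<And>i. i \<in> I \<Longrightarrow> int_family (c i)"
  shows "int_family (\<lambda>s. \<Sum>i\<in>I. c i s)"
  using assms
proof (induction I rule: infinite_finite_induct)
  case (insert x F)
  then show ?case by (simp add: int_family_add)
qed (use int_family_const[of 0] in auto)

text \<open>Substituting \<open>X ^ t\<close> into the representing polynomial is the Galois action
  of \<open>t\<close>.\<close>

lemma int_family_shift: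
  assumes "int_family c" "coprime t n"
  shows "int_family (\<lambda>s. c (t * s))"
proof -
  obtain f where f: "\<And>s. coprime s n \<Longrightarrow> c s = int_eval f (w ^ s)"
    using assms by (metis int_familyE)
  have "int_eval (pcompose f (monom 1 t)) x = int_eval f (x ^ t)" for x
    by (simp add: of_int_hom.map_poly_pcompose poly_pcompose)
  then show ?thesis
    using assms(2) by (intro int_familyI[of _ "pcompose f (monom 1 t)"])
      (auto simp: f power_mult[symmetric] mult.commute)
qed

lemma int_family_cong:
  assumes "int_family c" "[s = t] (mod n)" "coprime s n"
  shows "c s = c t"
proof -
  obtain f where f: "\<And>s. coprime s n \<Longrightarrow> c s = int_eval f (w ^ s)"
    using assms by (metis int_familyE)
  have "coprime t n" using assms(2,3) by (metis cong_imp_coprime)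
  then show ?thesis using f assms by (metis power_eq_iff)
qed

text \<open>With \<open>r\<close> inverse to \<open>s\<close> modulo \<open>n\<close>, the number
  \<open>w ^ t\<close> is the \<open>(r * t)\<close>-th power of \<open>w ^ s\<close>, so a relation
  at \<open>w ^ s\<close> passes to \<open>w ^ t\<close>.\<close>

lemma int_family_zero:
  assumes c: "int_family c" and s: "coprime s n" "c s = 0" and t: "coprime t n"
  shows "c t = 0"
proof -
  obtain f where f: "\<And>s. coprime s n \<Longrightarrow> c s = int_eval f (w ^ s)"
    using c by (metis int_familyE)
  obtain r where r: "[s * r = 1] (mod n)"
    using cong_solve_coprime_nat[OF s(1)] by auto
  have "coprime (s * r) n" using cong_imp_coprime[OF cong_sym[OF r]] by simp
  then have rt: "coprime (r * t) n" using t by simp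
  have "[s * (r * t) = 1 * t] (mod n)"
    using cong_scalar_right[OF r, of t] by (simp only: mult.assoc)
  then have "w ^ (s * (r * t)) = w ^ t"
    unfolding power_eq_iff by simp
  then have "w ^ t = (w ^ s) ^ (r * t)"
    unfolding power_mult by simp
  moreover have "int_eval f ((w ^ s) ^ (r * t)) = 0"
    using int_eval_root_coprime_power[OF n_pos power_power_eq_1 rt] f[OF s(1)] s(2) by metis
  ultimately show ?thesis using f[OF t] by simp
qed

text \<open>Reduce the representing polynomial modulo the minimal polynomial \<open>q\<close> to a
  remainder \<open>r\<close>. All roots of \<open>q\<close> are conjugates of \<open>w\<close>, so
  \<open>r - c 1\<close> vanishes at each of them. There are as many as the degree of
  \<open>q\<close>, which exceeds that of \<open>r\<close>, so \<open>r\<close> is a constant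
  polynomial with an integer coefficient.\<close>

lemma int_family_constant:
  assumes c: "int_family c" and const: "\<And>s. coprime s n \<Longrightarrow> c s = c 1"
  shows "c 1 \<in> \<int>"
proof -
  obtain f where f: "\<And>s. coprime s n \<Longrightarrow> c s = int_eval f (w ^ s)"
    using c by (metis int_familyE)
  obtain q where q: "lead_coeff q = 1" "Polynomial.degree q > 0"
    and min: "\<And>f. int_eval f w = 0 \<longleftrightarrow> q dvd f"
    using minimal_polynomial_root_of_unity[OF n_pos power_n] by blast
  obtain b r where br: "f = q * b + r" "r = 0 \<or> Polynomial.degree r < Polynomial.degree q"
    using monic_int_division[OF q(1)] by blast
  have "int_eval q w = 0" by (rule min[THEN iffD2]) simp
  then have "int_eval q (w ^ s) = 0" if "coprime s n" for s
    using int_eval_root_coprime_power[OF n_pos power_n that] by blast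
  then have r: "int_eval r (w ^ s) = c 1" if "coprime s n" for s
    using f[OF that] const[OF that] that by (simp add: br(1))
  define P where "P = map_poly of_int r - [:c 1:]"
  have P_root: "poly P x = 0" if "int_eval q x = 0" for x
    using minimal_polynomial_roots[OF min q(1) that] r by (auto simp: P_def)
  have P_deg: "Polynomial.degree P < Polynomial.degree q"
    unfolding P_def using br(2) q(2) by (intro degree_diff_less) auto
  have "q dvd monom 1 n - 1"
    using power_n by (intro min[THEN iffD1]) simp
  then obtain h where h: "monom 1 n - 1 = q * h" by blast
  have nz: "q \<noteq> 0" "h \<noteq> 0" using q(1) unity_poly_nonzero[OF n_pos, where 'a = int] h by auto
  have deg_h: "n = Polynomial.degree q + Polynomial.degree h"
    using nz degree_unity_poly[OF n_pos] unfolding h by (simp add: degree_mult_eq)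
  have fin: "finite {x. int_eval g x = 0}" if "g \<noteq> 0" for g
    using that by (intro poly_roots_finite) simp
  \<comment> \<open>Separability of \<open>q\<close> by counting: of the \<open>n\<close> distinct
    roots of \<open>X ^ n - 1\<close> at most \<open>degree h\<close> belong to \<open>h\<close>,
    which leaves at least \<open>degree q\<close> for \<open>q\<close>.\<close>
  have "n = card {x :: complex. x ^ n = 1}"
    using card_roots_unity_eq[of n] n_pos by simp
  also have "{x :: complex. x ^ n = 1} = {x. int_eval (monom 1 n - 1) x = 0}" by simp
  also have "\<dots> = {x. int_eval q x = 0} \<union> {x. int_eval h x = 0}" unfolding h by auto
  also have "card \<dots> \<le> card {x. int_eval q x = 0} + card {x. int_eval h x = 0}"
    by (rule card_Un_le)
  also have "card {x. int_eval h x = 0} \<le> Polynomial.degree h"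
    using card_poly_roots_bound[of "map_poly of_int h :: complex poly"] nz by simp
  finally have "Polynomial.degree q \<le> card {x. int_eval q x = 0}" using deg_h by simp
  moreover have "card {x. int_eval q x = 0} \<le> card {x. poly P x = 0}" if "P \<noteq> 0"
    using P_root poly_roots_finite[OF that] by (intro card_mono) auto
  moreover have "card {x. poly P x = 0} \<le> Polynomial.degree P" if "P \<noteq> 0"
    using card_poly_roots_bound[OF that] .
  ultimately have "P = 0" using P_deg by fastforce
  then have "poly.coeff P 0 = 0" by simp
  then have "c 1 = of_int (poly.coeff r 0)" by (simp add: P_def)
  then show ?thesis by simp
qed

text \<open>One denominator \<open>D\<close> serves all conjugates, so clearing it reduces each
  claim to integer families.\<close>

definition rat_family :: "(nat \<Rightarrow> complex) \<Rightarrow> bool" where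
  "rat_family c \<longleftrightarrow> (\<exists>D::nat. D > 0 \<and> int_family (\<lambda>s. of_nat D * c s))"

lemma rat_familyE:
  assumes "rat_family c"
  obtains D :: nat where "D > 0" "int_family (\<lambda>s. of_nat D * c s)"
  using assms unfolding rat_family_def by blast

lemma int_family_imp_rat_family: "int_family c \<Longrightarrow> rat_family c"
  unfolding rat_family_def by (intro exI[of _ 1]) simp

text \<open>Needed for formulas, such as the one for inverses, that are valid only at exponents
  coprime to \<open>n\<close>.\<close>

lemma rat_family_transfer:
  assumes "rat_family b" and "\<And>s. coprime s n \<Longrightarrow> b s = c s"
  shows "rat_family c"
  using assms by (auto simp: rat_family_def int_family_def)

lemma rat_family_const:
  assumes "x \<in> \<rat>"
  shows "rat_family (\<lambda>s. x)"
proof -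
  obtain a b where "b > 0" "x = of_int a / of_int b"
    using assms by (metis Rats_cases')
  then have "of_nat (nat b) * x = of_int a" by simp
  then show ?thesis
    unfolding rat_family_def using \<open>b > 0\<close> int_family_const[of a] by (intro exI[of _ "nat b"]) simp
qed

lemma rat_family_add:
  assumes "rat_family b" "rat_family c"
  shows "rat_family (\<lambda>s. b s + c s)"
proof -
  obtain D E where D: "D > 0" "int_family (\<lambda>s. of_nat D * b s)"
    and E: "E > 0" "int_family (\<lambda>s. of_nat E * c s)"
    using assms by (metis rat_familyE)
  have "int_family (\<lambda>s. of_int (int E) * (of_nat D * b s) + of_int (int D) * (of_nat E * c s))"
    by (intro int_family_add int_family_mult int_family_const D E)
  then have "int_family (\<lambda>s. of_nat (D * E) * (b s + c s))"
    by (simp add: algebra_simps)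
  then show ?thesis using D E unfolding rat_family_def by (intro exI[of _ "D * E"]) simp
qed

lemma rat_family_mult:
  assumes "rat_family b" "rat_family c"
  shows "rat_family (\<lambda>s. b s * c s)"
proof -
  obtain D E where D: "D > 0" "int_family (\<lambda>s. of_nat D * b s)"
    and E: "E > 0" "int_family (\<lambda>s. of_nat E * c s)"
    using assms by (metis rat_familyE)
  have "int_family (\<lambda>s. (of_nat D * b s) * (of_nat E * c s))"
    by (intro int_family_mult D E)
  then have "int_family (\<lambda>s. of_nat (D * E) * (b s * c s))"
    by (simp add: algebra_simps)
  then show ?thesis using D E unfolding rat_family_def by (intro exI[of _ "D * E"]) simp
qed

lemma rat_family_uminus: "rat_family c \<Longrightarrow> rat_family (\<lambda>s. - c s)"
  using rat_family_mult[OF rat_family_const[of "-1"]] by simp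

lemma rat_family_diff: "rat_family b \<Longrightarrow> rat_family c \<Longrightarrow> rat_family (\<lambda>s. b s - c s)"
  using rat_family_add[OF _ rat_family_uminus] by simp

lemma rat_family_sum:
  assumes "\<And>i. i \<in> I \<Longrightarrow> rat_family (c i)"
  shows "rat_family (\<lambda>s. \<Sum>i\<in>I. c i s)"
  using assms
proof (induction I rule: infinite_finite_induct)
  case (insert x F)
  then show ?case by (simp add: rat_family_add)
qed (use rat_family_const[of 0] in auto)

lemma rat_family_prod:
  assumes "\<And>i. i \<in> I \<Longrightarrow> rat_family (c i)"
  shows "rat_family (\<lambda>s. \<Prod>i\<in>I. c i s)"
  using assms
proof (induction I rule: infinite_finite_induct)
  case (insert x F)
  then show ?case by (simp add: rat_family_mult)
qed (use rat_family_const[of 1] in auto)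

lemma rat_family_shift:
  assumes "rat_family c" "coprime t n"
  shows "rat_family (\<lambda>s. c (t * s))"
proof -
  obtain D :: nat where D: "D > 0" "int_family (\<lambda>s. of_nat D * c s)"
    using assms(1) by (rule rat_familyE)
  show ?thesis
    using int_family_shift[OF D(2) assms(2)] D(1) by (auto simp: rat_family_def)
qed

lemma rat_family_cong:
  assumes "rat_family c" "[s = t] (mod n)" "coprime s n"
  shows "c s = c t"
proof -
  obtain D :: nat where D: "D > 0" "int_family (\<lambda>s. of_nat D * c s)"
    using assms(1) by (rule rat_familyE)
  show ?thesis using int_family_cong[OF D(2) assms(2,3)] D(1) by simp
qed

lemma rat_family_zero:
  assumes "rat_family c" "coprime s n" "c s = 0" "coprime t n"
  shows "c t = 0"
proof -
  obtain D :: nat where D: "D > 0" "int_family (\<lambda>s. of_nat D * c s)"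
    using assms(1) by (rule rat_familyE)
  show ?thesis using int_family_zero[OF D(2) assms(2) _ assms(4)] assms(3) D(1) by simp
qed

lemma rat_family_eq:
  assumes "rat_family b" "rat_family c" "coprime s n" "b s = c s" "coprime t n"
  shows "b t = c t"
  using rat_family_zero[OF rat_family_diff[OF assms(1,2)] assms(3) _ assms(5)] assms(4) by simp

lemma rat_family_constant:
  assumes c: "rat_family c" and const: "\<And>s. coprime s n \<Longrightarrow> c s = c 1"
  shows "c 1 \<in> \<rat>"
proof -
  obtain D :: nat where D: "D > 0" "int_family (\<lambda>s. of_nat D * c s)"
    using c by (rule rat_familyE)
  have "of_nat D * c 1 \<in> \<int>"
    using int_family_constant[OF D(2)] const by metis
  then have "of_nat D * c 1 / of_nat D \<in> \<rat>"
    using Ints_subset_Rats by (intro Rats_divide) auto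
  then show ?thesis using D(1) by simp
qed

text \<open>The inverse of an element is the product of its other conjugates, divided by its norm.\<close>

lemma rat_family_inverse:
  assumes c: "rat_family c" and nz: "c 1 \<noteq> 0"
  shows "rat_family (\<lambda>s. inverse (c s))"
proof -
  let ?U = "totatives n"
  have U1: "1 \<in> ?U" using n_gt_1 by (simp add: totatives_def)
  have cop: "coprime t n" if "t \<in> ?U" for t using that by (simp add: totatives_def)
  have c_nz: "c t \<noteq> 0" if "coprime t n" for t
    using rat_family_zero[OF c that] nz by auto
  have bij: "bij_betw (\<lambda>t. (t * s) mod n) ?U ?U" if s: "coprime s n" for s
  proof -
    have "inj_on (\<lambda>t. (t * s) mod n) ?U"
    proof (rule inj_onI)
      fix t u assume tu: "t \<in> ?U" "u \<in> ?U" and "(t * s) mod n = (u * s) mod n"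
      then have "[t = u] (mod n)"
        using s by (simp add: cong_def[symmetric] cong_mult_rcancel_nat)
      moreover have "t < n" "u < n" using tu n_gt_1 by (auto simp: totatives_less)
      ultimately show "t = u" by (simp add: cong_less_modulus_unique_nat)
    qed
    moreover have "(\<lambda>t. (t * s) mod n) ` ?U \<subseteq> ?U"
    proof
      fix y assume "y \<in> (\<lambda>t. (t * s) mod n) ` ?U"
      then obtain t where t: "t \<in> ?U" "y = (t * s) mod n" by blast
      then have "coprime (t * s) n" using cop s by simp
      then have "coprime y n" unfolding t(2) using n_pos by (subst coprime_mod_left_iff) auto
      moreover have "y \<noteq> 0" using calculation n_gt_1 by (metis coprime_0_left_iff nat_dvd_1_iff_1 nat_neq_iff is_unit_gcd)
      moreover have "y \<le> n" using t n_pos by (simp add: less_imp_le)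
      ultimately show "y \<in> ?U" by (simp add: totatives_def)
    qed
    ultimately show ?thesis
      by (simp add: bij_betw_def endo_inj_surj)
  qed
  \<comment> \<open>The norm, as a family. Multiplication by a unit \<open>s\<close> permutes its
    factors modulo \<open>n\<close>, so its value is the same at all conjugates and therefore
    rational.\<close>
  define N where "N = (\<lambda>s. \<Prod>t\<in>?U. c (t * s))"
  have "N s = (\<Prod>t\<in>?U. c ((t * s) mod n))" if "coprime s n" for s
    unfolding N_def using that cop by (intro prod.cong refl rat_family_cong[OF c]) (auto simp: cong_def)
  then have N: "N s = (\<Prod>t\<in>?U. c t)" if "coprime s n" for s
    using that prod.reindex_bij_betw[OF bij[OF that], of c] by simp
  have fam: "rat_family (\<lambda>s. c (t * s))" if "t \<in> ?U" for t
    by (rule rat_family_shift[OF c cop[OF that]])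
  have "rat_family N"
    unfolding N_def by (rule rat_family_prod) (rule fam)
  then have "N 1 \<in> \<rat>"
    by (rule rat_family_constant) (simp add: N)
  then have inv: "rat_family (\<lambda>s. inverse (N 1))" by (intro rat_family_const Rats_inverse)
  have "rat_family (\<lambda>s. inverse (N 1) * (\<Prod>t\<in>?U - {1}. c (t * s)))"
    by (intro rat_family_mult inv rat_family_prod) (use fam in auto)
  moreover have "inverse (N 1) * (\<Prod>t\<in>?U - {1}. c (t * s)) = inverse (c s)" if "coprime s n" for s
  proof -
    have "N 1 = N s" using N that by simp
    also have "\<dots> = c s * (\<Prod>t\<in>?U - {1}. c (t * s))"
      unfolding N_def using prod.remove[OF _ U1, of "\<lambda>t. c (t * s)"] by simp
    finally have "N 1 = c s * (\<Prod>t\<in>?U - {1}. c (t * s))" .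
    moreover have "N 1 \<noteq> 0" using c_nz cop by (auto simp: N)
    ultimately show ?thesis using c_nz[OF that] by (auto simp: field_simps)
  qed
  ultimately show ?thesis
    by (rule rat_family_transfer)
qed

end

section \<open>The degree of the field generated by a list of families\<close>

text \<open>The counting device of the proof: conjugates of a primitive element, tuples of conjugate
  eigenvalues, translates of the connection set and cosets are matched by comparing fibres, without
  explicit bijections.\<close>

lemma card_image_eq_if_same_fibers:
  assumes "\<And>x y. x \<in> A \<Longrightarrow> y \<in> A \<Longrightarrow> f x = f y \<longleftrightarrow> g x = g y"
  shows "card (f ` A) = card (g ` A)"
proof -
  define h where "h = (\<lambda>u. g (inv_into A f u))"
  have h: "h (f x) = g x" if "x \<in> A" for x
    using that assms[of "inv_into A f (f x)" x] by (simp add: h_def f_inv_into_f inv_into_into)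
  have "inj_on h (f ` A)"
    using h assms by (auto simp: inj_on_def)
  moreover have "h ` f ` A = g ` A"
    using h by (auto simp: image_image)
  ultimately show ?thesis by (metis card_image)
qed

section \<open>Interpolation at conjugates and primitive elements\<close>

context primitive_root_of_unity
begin

definition rat_poly_family :: "(nat \<Rightarrow> complex poly) \<Rightarrow> bool" where
  "rat_poly_family P \<longleftrightarrow> (\<forall>i. rat_family (\<lambda>s. poly.coeff (P s) i))"

lemma rat_poly_family_mult:
  assumes "rat_poly_family P" "rat_poly_family Q"
  shows "rat_poly_family (\<lambda>s. P s * Q s)"
  using assms unfolding rat_poly_family_def coeff_mult
  by (intro allI rat_family_sum rat_family_mult) auto

lemma rat_poly_family_smult:
  assumes "rat_family c" "rat_poly_family Q"
  shows "rat_poly_family (\<lambda>s. smult (c s) (Q s))"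
  using assms unfolding rat_poly_family_def coeff_smult
  by (intro allI rat_family_mult) auto

lemma rat_poly_family_sum:
  assumes "\<And>i. i \<in> I \<Longrightarrow> rat_poly_family (P i)"
  shows "rat_poly_family (\<lambda>s. \<Sum>i\<in>I. P i s)"
  using assms unfolding rat_poly_family_def coeff_sum
  by (intro allI rat_family_sum) auto

lemma rat_poly_family_linear:
  assumes "rat_family c"
  shows "rat_poly_family (\<lambda>s. [:c s, 1:])"
  unfolding rat_poly_family_def
proof
  fix i
  show "rat_family (\<lambda>s. poly.coeff [:c s, 1:] i)"
    using assms rat_family_const[of 0] rat_family_const[of 1]
    by (cases i) (auto simp: coeff_pCons split: nat.splits)
qed

lemma rat_poly_family_prod:
  assumes "\<And>i. i \<in> I \<Longrightarrow> rat_poly_family (P i)"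
  shows "rat_poly_family (\<lambda>s. \<Prod>i\<in>I. P i s)"
  using assms
proof (induction I rule: infinite_finite_induct)
  case (insert x F)
  then show ?case by (simp add: rat_poly_family_mult)
next
  case empty
  show ?case
    unfolding rat_poly_family_def by (auto intro!: rat_family_const simp: coeff_1)
next
  case (infinite A)
  then show ?case
    unfolding rat_poly_family_def by (auto intro!: rat_family_const simp: coeff_1)
qed

lemma rat_family_power: "rat_family c \<Longrightarrow> rat_family (\<lambda>s. c s ^ k)"
  by (induction k) (auto intro: rat_family_mult rat_family_const)

lemma rat_family_poly:
  assumes "rat_family \<theta>" "\<And>i. poly.coeff P i \<in> \<rat>"
  shows "rat_family (\<lambda>s. poly P (\<theta> s))"
  unfolding poly_altdef
  by (intro rat_family_sum rat_family_mult rat_family_power rat_family_const assms)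

text \<open>Infinitely many exponents give finitely many values, those at residues modulo
  \<open>n\<close>. For a rational family their number turns out to be the degree of
  \<open>\<theta> 1\<close> over \<rat>.\<close>

abbreviation conjugates :: "(nat \<Rightarrow> complex) \<Rightarrow> complex set" where
  "conjugates \<theta> \<equiv> \<theta> ` {s. coprime s n}"

lemma finite_conjugates:
  assumes "rat_family \<theta>"
  shows "finite (conjugates \<theta>)"
proof (rule finite_subset)
  show "conjugates \<theta> \<subseteq> \<theta> ` {..<n}"
  proof
    fix x assume "x \<in> conjugates \<theta>"
    then obtain s where s: "coprime s n" "x = \<theta> s" by blast
    have "\<theta> s = \<theta> (s mod n)"
      using s by (intro rat_family_cong[OF assms]) (auto simp: cong_def)
    then show "x \<in> \<theta> ` {..<n}" using s n_pos by auto
  qed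
qed simp

lemma conjugates_nonempty: "conjugates \<theta> \<noteq> {}"
  using coprime_1_left by blast

text \<open>A rational polynomial with one conjugate as a root has them all as roots, more than its
  degree permits. This gives the linear independence of the powers of
  \<open>\<theta> 1\<close>.\<close>

lemma rational_poly_eq_0:
  assumes \<theta>: "rat_family \<theta>" and P: "\<And>i. poly.coeff P i \<in> \<rat>"
    and deg: "Polynomial.degree P < card (conjugates \<theta>)" and zero: "poly P (\<theta> 1) = 0"
  shows "P = 0"
proof (rule poly_eqI_degree)
  show "poly P x = poly 0 x" if x: "x \<in> conjugates \<theta>" for x
    using rat_family_zero[OF rat_family_poly[OF \<theta> P], of 1] zero x by auto
qed (use deg in auto)

text \<open>Lagrange interpolation at the conjugates of \<open>\<theta>\<close>: carried out at all conjugates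
  simultaneously, it yields a family of polynomials which is constant by uniqueness, so that its
  coefficients are rational.\<close>

lemma rational_poly_interpolation:
  assumes \<theta>: "rat_family \<theta>" and z: "rat_family z"
    and fib: "\<And>s t. coprime s n \<Longrightarrow> coprime t n \<Longrightarrow> \<theta> s = \<theta> t \<Longrightarrow> z s = z t"
  shows "\<exists>P. (\<forall>i. poly.coeff P i \<in> \<rat>) \<and> Polynomial.degree P < card (conjugates \<theta>)
    \<and> poly P (\<theta> 1) = z 1"
proof -
  let ?C = "conjugates \<theta>"
  have fin: "finite ?C" by (rule finite_conjugates[OF \<theta>])
  have card_pos: "card ?C > 0" using fin conjugates_nonempty by (simp add: card_gt_0_iff)
  \<comment> \<open>A chosen exponent for each conjugate: \<open>\<theta> (\<rho> x * s)\<close> is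
    then the image of the node \<open>x\<close> under the Galois action of \<open>s\<close>.\<close>
  define \<rho> where "\<rho> = inv_into {s. coprime s n} \<theta>"
  have \<rho>: "coprime (\<rho> x) n" "\<theta> (\<rho> x) = x" if "x \<in> ?C" for x
    using inv_into_into[OF that] f_inv_into_f[OF that] by (auto simp: \<rho>_def)
  have fam: "rat_family (\<lambda>s. \<theta> (\<rho> x * s))" "rat_family (\<lambda>s. z (\<rho> x * s))" if "x \<in> ?C" for x
    using rat_family_shift[OF \<theta>] rat_family_shift[OF z] \<rho>[OF that] by auto
  have inj: "x = y" if "x \<in> ?C" "y \<in> ?C" "coprime s n" "\<theta> (\<rho> x * s) = \<theta> (\<rho> y * s)" for x y s
  proof -
    have "\<theta> (\<rho> x * 1) = \<theta> (\<rho> y * 1)"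
      by (rule rat_family_eq[OF fam(1)[OF that(1)] fam(1)[OF that(2)] that(3,4)]) simp
    then show ?thesis using \<rho> that by simp
  qed
  \<comment> \<open>\<open>P s\<close> is the Lagrange polynomial for the nodes moved by
    \<open>s\<close>: \<open>L\<close> collects the linear factors, and \<open>W\<close> the
    prescribed value with the inverted denominators.\<close>
  define W where "W = (\<lambda>x s. z (\<rho> x * s) * (\<Prod>y\<in>?C - {x}. inverse (\<theta> (\<rho> x * s) - \<theta> (\<rho> y * s))))"
  define L where "L = (\<lambda>x s. \<Prod>y\<in>?C - {x}. [:- \<theta> (\<rho> y * s), 1:])"
  define P where "P = (\<lambda>s. \<Sum>x\<in>?C. smult (W x s) (L x s))"
  have W_fam: "rat_family (W x)" if x: "x \<in> ?C" for x
    unfolding W_def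
  proof (intro rat_family_mult rat_family_prod fam x)
    fix y assume y: "y \<in> ?C - {x}"
    \<comment> \<open>Inversion requires a nonzero value at \<open>s = 1\<close> only, and there the
      difference is \<open>x - y\<close>.\<close>
    show "rat_family (\<lambda>s. inverse (\<theta> (\<rho> x * s) - \<theta> (\<rho> y * s)))"
      using y x \<rho> by (intro rat_family_inverse rat_family_diff fam) auto
  qed
  have L_fam: "rat_poly_family (L x)" for x
    unfolding L_def
    by (intro rat_poly_family_prod rat_poly_family_linear rat_family_uminus fam) auto
  have P_fam: "rat_poly_family P"
    unfolding P_def by (intro rat_poly_family_sum rat_poly_family_smult W_fam L_fam)
  have L_deg: "Polynomial.degree (L x s) < card ?C" if "x \<in> ?C" for x s
  proof -
    have "Polynomial.degree (L x s) \<le> (\<Sum>y\<in>?C - {x}. Polynomial.degree [:- \<theta> (\<rho> y * s), 1:])"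
      unfolding L_def by (rule degree_prod_sum_le[unfolded o_def]) (use fin in simp)
    also have "\<dots> = card ?C - 1" using that fin by simp
    finally show ?thesis using card_pos by simp
  qed
  have P_deg: "Polynomial.degree (P s) < card ?C" for s
    unfolding P_def
    by (rule degree_sum_less) (use L_deg card_pos degree_smult_le le_less_trans in blast)+
  have P_eval: "poly (P s) (\<theta> (\<rho> x * s)) = z (\<rho> x * s)" if x: "x \<in> ?C" and s: "coprime s n" for x s
  proof -
    have "poly (L y s) (\<theta> (\<rho> x * s)) = 0" if "y \<in> ?C - {x}" for y
      unfolding L_def poly_prod using fin x that by (intro prod_zero) auto
    then have "poly (P s) (\<theta> (\<rho> x * s)) = W x s * poly (L x s) (\<theta> (\<rho> x * s))"
      unfolding P_def poly_sum by (subst sum.remove[OF fin x]) simp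
    also have "\<dots> = z (\<rho> x * s) * (\<Prod>y\<in>?C - {x}. inverse (\<theta> (\<rho> x * s) - \<theta> (\<rho> y * s)) * (\<theta> (\<rho> x * s) - \<theta> (\<rho> y * s)))"
      by (simp add: W_def L_def poly_prod prod.distrib)
    also have "(\<Prod>y\<in>?C - {x}. inverse (\<theta> (\<rho> x * s) - \<theta> (\<rho> y * s)) * (\<theta> (\<rho> x * s) - \<theta> (\<rho> y * s))) = (\<Prod>y\<in>?C - {x}. 1)"
      using inj[OF x _ s] by (intro prod.cong refl left_inverse) auto
    finally show ?thesis by simp
  qed
  have P_conj: "poly (P s) x = z t" if s: "coprime s n" and t: "coprime t n" "x = \<theta> t" for s t x
  proof -
    \<comment> \<open>Moving by \<open>s\<close> permutes the nodes. So each \<open>P s\<close>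
      solves the same interpolation problem, with value \<open>z t\<close> at
      \<open>\<theta> t\<close>.\<close>
    have "(\<lambda>y. \<theta> (\<rho> y * s)) ` ?C \<subseteq> ?C" using \<rho>(1) s by auto
    moreover have "inj_on (\<lambda>y. \<theta> (\<rho> y * s)) ?C" using inj[OF _ _ s] by (auto simp: inj_on_def)
    ultimately have "(\<lambda>y. \<theta> (\<rho> y * s)) ` ?C = ?C" using fin by (simp add: endo_inj_surj)
    moreover have "\<theta> t \<in> ?C" using t by blast
    ultimately obtain y where y: "y \<in> ?C" "\<theta> t = \<theta> (\<rho> y * s)" by (metis (no_types, lifting) imageE)
    have "z t = z (\<rho> y * s)" using y \<rho> s t by (intro fib) auto
    then show ?thesis using P_eval[OF y(1) s] y t by simp
  qed
  have P_const: "P s = P 1" if "coprime s n" for s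
  proof (rule poly_eqI_degree)
    fix x assume "x \<in> ?C"
    then obtain t where "coprime t n" "x = \<theta> t" by blast
    then show "poly (P s) x = poly (P 1) x" using P_conj that by simp
  qed (rule P_deg)+
  have "poly.coeff (P 1) i \<in> \<rat>" for i
  proof (rule rat_family_constant[of "\<lambda>s. poly.coeff (P s) i"])
    show "rat_family (\<lambda>s. poly.coeff (P s) i)"
      using P_fam by (simp add: rat_poly_family_def)
    show "poly.coeff (P s) i = poly.coeff (P 1) i" if "coprime s n" for s
      by (rule arg_cong[OF P_const[OF that]])
  qed
  moreover have "poly (P 1) (\<theta> 1) = z 1" using P_conj by simp
  ultimately show ?thesis using P_deg by blast
qed

text \<open>The primitive element argument: two tuples of conjugates that differ define a nonzero
  polynomial with coefficients \<open>c j s - c j t\<close>, and \<open>N\<close> is chosen off the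
  roots of all of these. A natural number keeps the combination inside the field generated by the
  \<open>c j 1\<close>.\<close>

lemma separating_family:
  assumes c: "\<And>j. j < m \<Longrightarrow> rat_family (c j)"
  obtains N :: nat
  where "\<And>s t. coprime s n \<Longrightarrow> coprime t n \<Longrightarrow>
    (\<Sum>j<m. of_nat N ^ j * c j s) = (\<Sum>j<m. of_nat N ^ j * c j t) \<longleftrightarrow> (\<forall>j<m. c j s = c j t)"
proof -
  define D where "D = (\<lambda>(s, t). \<Sum>j<m. monom (c j s - c j t) j)"
  have D_coeff: "poly.coeff (D (s, t)) j = c j s - c j t" if "j < m" for s t j
    using that by (simp add: D_def coeff_sum)
  \<comment> \<open>Exponents below \<open>n\<close> represent all residues, which keeps the set of
    forbidden values finite.\<close>
  define B where "B = (\<Union>p\<in>{p \<in> {..<n} \<times> {..<n}. D p \<noteq> 0}. {x. poly (D p) x = 0})"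
  have "finite B" unfolding B_def using poly_roots_finite by (intro finite_UN_I) auto
  then have "finite (of_nat -` B :: nat set)" by (intro finite_vimageI) (auto intro: inj_of_nat)
  then obtain N :: nat where N: "of_nat N \<notin> B"
    using infinite_UNIV_nat by (metis finite_subset subsetI vimageI)
  have main: "\<forall>j<m. c j s = c j t"
    if s: "coprime s n" "s < n" and t: "coprime t n" "t < n"
      and eq: "(\<Sum>j<m. of_nat N ^ j * c j s) = (\<Sum>j<m. of_nat N ^ j * c j t)" for s t
  proof -
    have "poly (D (s, t)) (of_nat N) = (\<Sum>j<m. of_nat N ^ j * c j s) - (\<Sum>j<m. of_nat N ^ j * c j t)"
      by (simp add: D_def poly_sum sum_subtractf algebra_simps)
    then have "D (s, t) = 0" using N s t eq unfolding B_def by auto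
    then show ?thesis using D_coeff[of _ s t] by auto
  qed
  show ?thesis
  proof (rule that, intro iffI)
    fix s t assume s: "coprime s n" and t: "coprime t n"
      and eq: "(\<Sum>j<m. of_nat N ^ j * c j s) = (\<Sum>j<m. of_nat N ^ j * c j t)"
    have mod: "c j s = c j (s mod n)" "c j t = c j (t mod n)" if "j < m" for j
      using s t by (auto intro!: rat_family_cong[OF c[OF that]] simp: cong_def)
    have "\<forall>j<m. c j (s mod n) = c j (t mod n)"
      using s t n_pos eq mod by (intro main) (auto simp: coprime_mod_left_iff)
    then show "\<forall>j<m. c j s = c j t" using mod by simp
  qed simp
qed

end

section \<open>Dimension over the rationals in the complex numbers\<close>

interpretation complex_ring: ring "ring_of_type_algebra :: complex ring"
  by (rule ring_from_type_algebra)

lemma complex_ring_simps [simp]: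
  "carrier (ring_of_type_algebra :: complex ring) = UNIV"
  "\<zero>\<^bsub>(ring_of_type_algebra :: complex ring)\<^esub> = 0"
  "\<one>\<^bsub>(ring_of_type_algebra :: complex ring)\<^esub> = 1"
  "x \<oplus>\<^bsub>(ring_of_type_algebra :: complex ring)\<^esub> y = x + y"
  "x \<otimes>\<^bsub>(ring_of_type_algebra :: complex ring)\<^esub> y = x * y"
  by (simp_all add: ring_of_type_algebra_def)

lemma complex_ring_a_inv [simp]: "\<ominus>\<^bsub>(ring_of_type_algebra :: complex ring)\<^esub> x = - x"
proof -
  have "x + (\<ominus>\<^bsub>(ring_of_type_algebra :: complex ring)\<^esub> x) = 0"
    using complex_ring.r_neg[of x] by simp
  then show ?thesis by (simp add: add_eq_0_iff)
qed

lemma complex_ring_m_inv [simp]: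
  assumes "x \<noteq> 0"
  shows "inv\<^bsub>(ring_of_type_algebra :: complex ring)\<^esub> x = inverse x"
proof -
  have "x * (inv\<^bsub>(ring_of_type_algebra :: complex ring)\<^esub> x) = 1"
    using field.field_Units[OF field_from_type_algebra[where 'a = complex]] complex_ring.Units_r_inv[of x] assms by simp
  then show ?thesis using assms by (metis inverse_unique)
qed

text \<open>\<open>combine\<close> stops at the end of the shorter list, hence the
  \<open>min\<close>.\<close>

lemma complex_ring_combine:
  "complex_ring.combine ks us = (\<Sum>i<min (length ks) (length us). ks ! i * us ! i)"
proof (induction ks us rule: list_induct2')
  case (4 k ks u us)
  then show ?case by (simp add: sum.lessThan_Suc_shift del: sum.lessThan_Suc)
qed simp_all

lemma subfield_Rats: "subfield \<rat> (ring_of_type_algebra :: complex ring)"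
  by (rule field.subfieldI'[OF field_from_type_algebra], rule complex_ring.subringI) auto

text \<open>Rational polynomials of degree below \<open>r\<close> correspond to coefficient lists of
  length \<open>r\<close>. In these terms the hypotheses say that the powers of
  \<open>\<theta>\<close> with exponent below \<open>r\<close> are independent and span
  \<open>E\<close>.\<close>

lemma dim_of_powers:
  fixes \<theta> :: complex
  assumes indep: "\<And>P. (\<And>i. poly.coeff P i \<in> \<rat>) \<Longrightarrow> Polynomial.degree P < r \<Longrightarrow> poly P \<theta> = 0 \<Longrightarrow> P = 0"
    and span: "E = {poly P \<theta> |P. (\<forall>i. poly.coeff P i \<in> \<rat>) \<and> Polynomial.degree P < r}"
    and r: "r > 0"
  shows "ring.dim (ring_of_type_algebra :: complex ring) \<rat> E = r"
proof -
  define us where "us = map (\<lambda>i. \<theta> ^ i) [0..<r]"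
  have comb: "complex_ring.combine ks us = poly (\<Sum>i<r. monom (ks ! i) i) \<theta>" if "length ks = r" for ks
    using that by (subst complex_ring_combine) (auto simp: us_def poly_sum)
  have coeff: "poly.coeff (\<Sum>i<r. monom (ks ! i) i) j = (if j < r then ks ! j else 0)" for ks :: "complex list" and j
    by (simp add: coeff_sum)
  have deg: "Polynomial.degree (\<Sum>i<r. monom (ks ! i) i) < r" for ks :: "complex list"
    using r by (intro degree_sum_less) (auto intro: le_less_trans[OF degree_monom_le])
  have rat: "poly.coeff (\<Sum>i<r. monom (ks ! i) i) j \<in> \<rat>" if "length ks = r" "set ks \<subseteq> \<rat>" for ks :: "complex list" and j
    unfolding coeff using that nth_mem[of j ks] by auto
  have "complex_ring.independent \<rat> us"
  proof (rule complex_ring.trivial_combine_imp_independent[OF subfield_Rats])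
    fix ks assume ks: "set ks \<subseteq> \<rat>" "complex_ring.combine ks us = \<zero>\<^bsub>ring_of_type_algebra\<^esub>"
    \<comment> \<open>The independence criterion admits coefficient lists of any length, so both a
      short and a long \<open>ks\<close> must be turned into a polynomial.\<close>
    define P where "P = (\<Sum>i<min (length ks) r. monom (ks ! i) i)"
    have P_coeff: "poly.coeff P j = (if j < min (length ks) r then ks ! j else 0)" for j
      by (simp add: P_def coeff_sum)
    have "poly.coeff P j \<in> \<rat>" for j
      unfolding P_coeff using ks(1) nth_mem[of j ks] by auto
    moreover have "Polynomial.degree P < r"
      unfolding P_def using r by (intro degree_sum_less) (auto intro: le_less_trans[OF degree_monom_le])
    moreover have "poly P \<theta> = 0"
      using ks(2) by (simp add: complex_ring_combine us_def P_def poly_sum)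
    ultimately have "P = 0" by (rule indep)
    then have "ks ! j = 0" if "j < min (length ks) r" for j
      using P_coeff[of j] that by simp
    then show "set (take (length us) ks) \<subseteq> {\<zero>\<^bsub>ring_of_type_algebra\<^esub>}"
      by (auto simp: in_set_conv_nth us_def)
  qed simp
  moreover have "complex_ring.Span \<rat> us = E"
  proof -
    have "complex_ring.Span \<rat> us = {complex_ring.combine ks us |ks. length ks = length us \<and> set ks \<subseteq> \<rat>}"
      by (rule complex_ring.Span_eq_combine_set_length_version[OF subfield_Rats]) simp
    also have "\<dots> = E"
    proof (intro equalityI subsetI)
      fix x assume "x \<in> {complex_ring.combine ks us |ks. length ks = length us \<and> set ks \<subseteq> \<rat>}"
      then obtain ks where ks: "length ks = r" "set ks \<subseteq> \<rat>" "x = complex_ring.combine ks us"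
        by (auto simp: us_def)
      then show "x \<in> E" unfolding span using comb deg rat by blast
    next
      fix x assume "x \<in> E"
      then obtain P where P: "\<And>i. poly.coeff P i \<in> \<rat>" "Polynomial.degree P < r" "x = poly P \<theta>"
        unfolding span by blast
      define ks where "ks = map (poly.coeff P) [0..<r]"
      have "(\<Sum>i<r. monom (ks ! i) i) = P"
      proof (rule poly_eqI)
        fix j show "poly.coeff (\<Sum>i<r. monom (ks ! i) i) j = poly.coeff P j"
          unfolding coeff using P(2) by (cases "j < r") (simp_all add: ks_def coeff_eq_0)
      qed
      moreover have "length ks = length us" "set ks \<subseteq> \<rat>" "length ks = r"
        using P(1) by (auto simp: ks_def us_def)
      ultimately show "x \<in> {complex_ring.combine ks us |ks. length ks = length us \<and> set ks \<subseteq> \<rat>}"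
        using comb[of ks] P(3) unfolding mem_Collect_eq by (intro exI[of _ ks]) simp
    qed
    finally show ?thesis .
  qed
  ultimately have "complex_ring.dimension (length us) \<rat> E"
    by (rule complex_ring.dimensionI[OF subfield_Rats])
  then have "(complex_ring.dim over \<rat>) E = length us"
    by (rule complex_ring.dimI[OF subfield_Rats])
  moreover have "length us = r" by (simp add: us_def)
  ultimately show ?thesis unfolding over_def by simp
qed

context primitive_root_of_unity
begin

text \<open>For the primitive element \<open>\<theta> 1\<close>, the generated field lies in the set
  \<open>V\<close> of elements whose conjugates depend only on those of \<open>\<theta>\<close>.
  Interpolation writes \<open>V\<close> as polynomial values at \<open>\<theta> 1\<close>, and these
  lie in the generated field again. The dimension is thus the number of conjugates of
  \<open>\<theta>\<close>, which distinguishes the same exponents as the tuple of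
  generators.\<close>

theorem degree_of_family_field:
  assumes c: "\<And>j. j < m \<Longrightarrow> rat_family (c j)"
  shows "ring.dim (ring_of_type_algebra :: complex ring) \<rat>
      (generate_field ring_of_type_algebra (\<rat> \<union> (\<lambda>j. c j 1) ` {..<m}))
    = card ((\<lambda>s. map (\<lambda>j. c j s) [0..<m]) ` {s. coprime s n})"
    (is "_ = card (?f ` _)")
proof -
  let ?R = "ring_of_type_algebra :: complex ring"
  let ?F = "generate_field ?R (\<rat> \<union> (\<lambda>j. c j 1) ` {..<m})"
  obtain N :: nat where N: "\<And>s t. coprime s n \<Longrightarrow> coprime t n \<Longrightarrow>
      (\<Sum>j<m. of_nat N ^ j * c j s) = (\<Sum>j<m. of_nat N ^ j * c j t) \<longleftrightarrow> (\<forall>j<m. c j s = c j t)"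
    by (rule separating_family[where c = c and m = m]) (use c in blast)+
  define \<theta> where "\<theta> = (\<lambda>s. \<Sum>j<m. of_nat N ^ j * c j s)"
  have \<theta>: "rat_family \<theta>"
    unfolding \<theta>_def by (intro rat_family_sum rat_family_mult rat_family_const c) auto
  have \<theta>_eq: "\<theta> s = \<theta> t \<longleftrightarrow> (\<forall>j<m. c j s = c j t)" if "coprime s n" "coprime t n" for s t
    unfolding \<theta>_def by (rule N[OF that])
  define r where "r = card (conjugates \<theta>)"
  have r: "r > 0"
    unfolding r_def using finite_conjugates[OF \<theta>] conjugates_nonempty by (simp add: card_gt_0_iff)
  have card: "r = card (?f ` {s. coprime s n})"
    unfolding r_def by (rule card_image_eq_if_same_fibers) (auto simp: \<theta>_eq)
  \<comment> \<open>In Galois terms, the fixed field of the stabilizer of \<open>\<theta> 1\<close>.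
    Closure under the field operations is checked on families.\<close>
  define V where "V = {z 1 |z. rat_family z \<and> (\<forall>s t. coprime s n \<longrightarrow> coprime t n \<longrightarrow> \<theta> s = \<theta> t \<longrightarrow> z s = z t)}"
  have VI: "z 1 \<in> V" if "rat_family z" "\<And>s t. coprime s n \<Longrightarrow> coprime t n \<Longrightarrow> \<theta> s = \<theta> t \<Longrightarrow> z s = z t" for z
    using that unfolding V_def by blast
  have F_V: "x \<in> V" if "x \<in> ?F" for x
    using that
  proof (induction x rule: generate_field.induct)
    case one
    show ?case using VI[of "\<lambda>s. 1"] rat_family_const[of 1] by simp
  next
    case (incl h)
    then consider "h \<in> \<rat>" | j where "j < m" "h = c j 1" by blast
    then show ?case
    proof cases
      case 1
      then show ?thesis using VI[of "\<lambda>s. h"] rat_family_const[of h] by simp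
    next
      case 2
      have "c j 1 \<in> V"
        by (rule VI[OF c[OF 2(1)]]) (use \<theta>_eq 2(1) in blast)
      then show ?thesis using 2(2) by simp
    qed
  next
    case (a_inv h)
    then obtain z where z: "h = z 1" "rat_family z" "\<forall>s t. coprime s n \<longrightarrow> coprime t n \<longrightarrow> \<theta> s = \<theta> t \<longrightarrow> z s = z t"
      unfolding V_def by blast
    have "- z 1 \<in> V"
      by (rule VI[OF rat_family_uminus[OF z(2)]], rule arg_cong[of _ _ uminus]) (use z(3) in blast)
    then show ?case using z(1) by simp
  next
    case (m_inv h)
    then obtain z where z: "h = z 1" "rat_family z" "\<forall>s t. coprime s n \<longrightarrow> coprime t n \<longrightarrow> \<theta> s = \<theta> t \<longrightarrow> z s = z t"
      unfolding V_def by blast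
    have nz: "z 1 \<noteq> 0" using m_inv(2) z(1) by simp
    have "inverse (z 1) \<in> V"
      by (rule VI[OF rat_family_inverse[OF z(2) nz]], rule arg_cong[of _ _ inverse]) (use z(3) in blast)
    then show ?case using z(1) nz by simp
  next
    case (eng_add h1 h2)
    then obtain z y where z: "h1 = z 1" "rat_family z" "\<forall>s t. coprime s n \<longrightarrow> coprime t n \<longrightarrow> \<theta> s = \<theta> t \<longrightarrow> z s = z t"
      and y: "h2 = y 1" "rat_family y" "\<forall>s t. coprime s n \<longrightarrow> coprime t n \<longrightarrow> \<theta> s = \<theta> t \<longrightarrow> y s = y t"
      unfolding V_def by blast
    have "z 1 + y 1 \<in> V"
    proof (rule VI[OF rat_family_add[OF z(2) y(2)]])
      fix s t assume "coprime s n" "coprime t n" "\<theta> s = \<theta> t"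
      then have "z s = z t" "y s = y t" using z(3) y(3) by blast+
      then show "z s + y s = z t + y t" by simp
    qed
    then show ?case using z(1) y(1) by simp
  next
    case (eng_mult h1 h2)
    then obtain z y where z: "h1 = z 1" "rat_family z" "\<forall>s t. coprime s n \<longrightarrow> coprime t n \<longrightarrow> \<theta> s = \<theta> t \<longrightarrow> z s = z t"
      and y: "h2 = y 1" "rat_family y" "\<forall>s t. coprime s n \<longrightarrow> coprime t n \<longrightarrow> \<theta> s = \<theta> t \<longrightarrow> y s = y t"
      unfolding V_def by blast
    have "z 1 * y 1 \<in> V"
    proof (rule VI[OF rat_family_mult[OF z(2) y(2)]])
      fix s t assume "coprime s n" "coprime t n" "\<theta> s = \<theta> t"
      then have "z s = z t" "y s = y t" using z(3) y(3) by blast+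
      then show "z s * y s = z t * y t" by simp
    qed
    then show ?case using z(1) y(1) by simp
  qed
  define F where "F = ?F"
  have add: "x + y \<in> F" if "x \<in> F" "y \<in> F" for x y
    using generate_field.eng_add[OF that[unfolded F_def]] by (simp add: F_def)
  have mult: "x * y \<in> F" if "x \<in> F" "y \<in> F" for x y
    using generate_field.eng_mult[OF that[unfolded F_def]] by (simp add: F_def)
  have rat: "x \<in> F" if "x \<in> \<rat>" for x
    using that unfolding F_def by (intro generate_field.incl) simp
  have sum: "(\<Sum>i\<in>I. g i) \<in> F" if "finite I" "\<And>i. i \<in> I \<Longrightarrow> g i \<in> F" for I :: "nat set" and g
    using that by (induction I rule: finite_induct) (auto intro: add rat)
  have c_F: "c j 1 \<in> F" if "j < m" for j
    using that unfolding F_def by (intro generate_field.incl) auto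
  have "of_nat N ^ j * c j 1 \<in> F" if "j < m" for j
    by (rule mult[OF rat c_F[OF that]]) simp
  then have \<theta>_F: "\<theta> 1 \<in> F"
    unfolding \<theta>_def by (intro sum) auto
  have pow_F: "\<theta> 1 ^ i \<in> F" for i
  proof (induction i)
    case (Suc i)
    then show ?case using mult[OF \<theta>_F] by simp
  qed (simp add: rat)
  have poly_F: "poly P (\<theta> 1) \<in> F" if "\<And>i. poly.coeff P i \<in> \<rat>" for P
    unfolding poly_altdef by (rule sum[OF _ mult[OF rat[OF that] pow_F]]) simp
  have "?F = {poly P (\<theta> 1) |P. (\<forall>i. poly.coeff P i \<in> \<rat>) \<and> Polynomial.degree P < r}"
  proof (intro equalityI subsetI)
    fix x assume "x \<in> ?F"
    then obtain z where z: "x = z 1" "rat_family z" "\<forall>s t. coprime s n \<longrightarrow> coprime t n \<longrightarrow> \<theta> s = \<theta> t \<longrightarrow> z s = z t"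
      using F_V unfolding V_def by blast
    obtain P where "\<forall>i. poly.coeff P i \<in> \<rat>" "Polynomial.degree P < r" "poly P (\<theta> 1) = z 1"
      using rational_poly_interpolation[OF \<theta> z(2)] z(3) unfolding r_def by blast
    then show "x \<in> {poly P (\<theta> 1) |P. (\<forall>i. poly.coeff P i \<in> \<rat>) \<and> Polynomial.degree P < r}"
      using z(1) by force
  next
    fix x assume "x \<in> {poly P (\<theta> 1) |P. (\<forall>i. poly.coeff P i \<in> \<rat>) \<and> Polynomial.degree P < r}"
    then show "x \<in> ?F" using poly_F unfolding F_def by blast
  qed
  then have "ring.dim ?R \<rat> ?F = r"
      by (intro dim_of_powers rational_poly_eq_0[OF \<theta>] r) (simp_all add: r_def)
  then show ?thesis by (simp only: card)
qed

end

section \<open>Eigenvalues of Cayley graphs of cyclic groups\<close>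

text \<open>Viewing eigenvectors as functions on the group removes the enumeration of the vertices.
  The arcs from \<open>g\<close> lead to the elements \<open>s \<otimes> g\<close>, so the adjacency
  operator is a sum of translations.\<close>

lemma (in group) Cay_eigenvalues_iff:
  assumes fin: "finite (carrier G)" and S: "S \<subseteq> carrier G"
  shows "graph_eigenvalues (Cay G S) =
    {x. \<exists>f. (\<exists>g\<in>carrier G. f g \<noteq> 0) \<and> (\<forall>g\<in>carrier G. (\<Sum>s\<in>S. f (s \<otimes> g)) = x * f g)}"
proof -
  have action: "(\<Sum>h\<in>carrier G. (if (g, h) \<in> parcs (Cay G S) then 1 else 0) * f h) = (\<Sum>s\<in>S. f (s \<otimes> g))"
    if g: "g \<in> carrier G" for f :: "'a \<Rightarrow> complex" and g
  proof -
    have "(\<Sum>s\<in>S. f (s \<otimes> g)) = (\<Sum>h\<in>{h \<in> carrier G. h \<otimes> inv g \<in> S}. f h)"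
    proof (rule sum.reindex_bij_witness[of _ "\<lambda>h. h \<otimes> inv g" "\<lambda>s. s \<otimes> g"])
    qed (use S g in \<open>auto simp: m_assoc\<close>)
    also have "\<dots> = (\<Sum>h\<in>carrier G. if h \<otimes> inv g \<in> S then f h else 0)"
      using fin by (simp add: sum.inter_filter)
    also have "\<dots> = (\<Sum>h\<in>carrier G. (if (g, h) \<in> parcs (Cay G S) then 1 else 0) * f h)"
      using g by (intro sum.cong) (auto simp: Cay_def)
    finally show ?thesis ..
  qed
  have eig: "(adjacency_matrix vs (Cay G S) *\<^sub>v vec (length vs) (\<lambda>i. f (vs ! i))) $ i = (\<Sum>s\<in>S. f (s \<otimes> vs ! i))"
    if vs: "distinct vs" "set vs = carrier G" and i: "i < length vs" for vs f i
  proof -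
    have "(adjacency_matrix vs (Cay G S) *\<^sub>v vec (length vs) (\<lambda>i. f (vs ! i))) $ i
      = (\<Sum>j = 0..<length vs. (if (vs ! i, vs ! j) \<in> parcs (Cay G S) then 1 else 0) * f (vs ! j))"
      using i by (simp add: adjacency_matrix_def scalar_prod_def)
    also have "\<dots> = (\<Sum>h\<in>set vs. (if (vs ! i, h) \<in> parcs (Cay G S) then 1 else 0) * f h)"
      by (rule sum.reindex_bij_betw) (use vs bij_betw_nth[OF vs(1)] in \<open>auto simp: atLeast0LessThan\<close>)
    finally show ?thesis
      using action[of "vs ! i" f] nth_mem[OF i] vs(2) by simp
  qed
  have "(\<exists>vs. distinct vs \<and> set vs = pverts (Cay G S) \<and> eigenvalue (adjacency_matrix vs (Cay G S)) x)
    \<longleftrightarrow> (\<exists>f. (\<exists>g\<in>carrier G. f g \<noteq> 0) \<and> (\<forall>g\<in>carrier G. (\<Sum>s\<in>S. f (s \<otimes> g)) = x * f g))"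
    (is "?L \<longleftrightarrow> ?R") for x
  proof
    assume ?L
    then obtain vs v where vs: "distinct vs" "set vs = carrier G"
      and v: "eigenvector (adjacency_matrix vs (Cay G S)) v x"
      unfolding eigenvalue_def by (auto simp: Cay_def)
    have dim: "dim_row (adjacency_matrix vs (Cay G S)) = length vs" by (simp add: adjacency_matrix_def)
    define f where "f = (\<lambda>g. v $ (inv_into {..<length vs} ((!) vs) g))"
    have f: "f (vs ! i) = v $ i" if "i < length vs" for i
      using that vs(1) by (simp add: f_def inv_into_f_f inj_on_nth)
    have v_carrier: "v \<in> carrier_vec (length vs)" and v_nz: "v \<noteq> 0\<^sub>v (length vs)"
      and v_eig: "adjacency_matrix vs (Cay G S) *\<^sub>v v = x \<cdot>\<^sub>v v"
      using v unfolding eigenvector_def dim by auto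
    have v_eq: "v = vec (length vs) (\<lambda>i. f (vs ! i))"
      using v_carrier f by (intro eq_vecI) auto
    have "\<exists>i<length vs. v $ i \<noteq> 0"
    proof (rule ccontr)
      assume "\<not> (\<exists>i<length vs. v $ i \<noteq> 0)"
      then have "v = 0\<^sub>v (length vs)" using v_carrier by (intro eq_vecI) auto
      then show False using v_nz by contradiction
    qed
    then obtain i where i: "i < length vs" "v $ i \<noteq> 0" by blast
    have "\<exists>g\<in>carrier G. f g \<noteq> 0"
      using i f[OF i(1)] nth_mem[OF i(1)] vs(2) by (intro bexI[of _ "vs ! i"]) simp_all
    moreover have "(\<Sum>s\<in>S. f (s \<otimes> g)) = x * f g" if "g \<in> carrier G" for g
    proof -
      have "g \<in> set vs" using that vs(2) by simp
      then obtain j where j: "j < length vs" "g = vs ! j" by (auto simp: in_set_conv_nth)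
      have "(\<Sum>s\<in>S. f (s \<otimes> g)) = (x \<cdot>\<^sub>v v) $ j"
        unfolding j(2) eig[OF vs j(1), of f, symmetric] v_eq[symmetric] v_eig ..
      also have "\<dots> = x * f g" unfolding j(2) f[OF j(1)] using j(1) v_carrier by simp
      finally show ?thesis .
    qed
    ultimately show ?R by blast
  next
    assume ?R
    then obtain f g0 where g0: "g0 \<in> carrier G" "f g0 \<noteq> 0"
      and f: "\<And>g. g \<in> carrier G \<Longrightarrow> (\<Sum>s\<in>S. f (s \<otimes> g)) = x * f g" by blast
    obtain vs where vs: "distinct vs" "set vs = carrier G"
      using finite_distinct_list[OF fin] by blast
    define v where "v = vec (length vs) (\<lambda>i. f (vs ! i))"
    have "g0 \<in> set vs" using g0(1) vs(2) by simp
    then obtain i where i: "i < length vs" "g0 = vs ! i" by (auto simp: in_set_conv_nth)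
    have "v $ i \<noteq> 0" using i g0 by (simp add: v_def)
    then have "v \<noteq> 0\<^sub>v (length vs)" using i by auto
    moreover have "adjacency_matrix vs (Cay G S) *\<^sub>v v = x \<cdot>\<^sub>v v"
    proof (rule eq_vecI)
      show "dim_vec (adjacency_matrix vs (Cay G S) *\<^sub>v v) = dim_vec (x \<cdot>\<^sub>v v)"
        by (simp add: adjacency_matrix_def v_def)
    next
      fix i assume "i < dim_vec (x \<cdot>\<^sub>v v)"
      then have i: "i < length vs" by (simp add: v_def)
      then have "vs ! i \<in> carrier G" using vs(2) nth_mem by blast
      then show "(adjacency_matrix vs (Cay G S) *\<^sub>v v) $ i = (x \<cdot>\<^sub>v v) $ i"
        unfolding v_def eig[OF vs i] using f i by simp
    qed
    ultimately have "eigenvector (adjacency_matrix vs (Cay G S)) v x"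
      by (simp add: eigenvector_def adjacency_matrix_def v_def)
    then show ?L using vs by (auto simp: eigenvalue_def Cay_def)
  qed
  then show ?thesis unfolding graph_eigenvalues_def by simp
qed

context primitive_root_of_unity
begin

text \<open>A geometric sum whose ratio is an \<open>n\<close>-th root of unity.\<close>

lemma power_orthogonality:
  "(\<Sum>j<n. w ^ (j * e) * inverse w ^ (j * i)) = (if [e = i] (mod n) then of_nat n else 0)"
proof -
  define x where "x = w ^ e * inverse w ^ i"
  have "(\<Sum>j<n. w ^ (j * e) * inverse w ^ (j * i)) = (\<Sum>j<n. x ^ j)"
    by (intro sum.cong) (simp_all add: x_def power_mult_distrib power_mult[symmetric] mult.commute)
  moreover have "x = 1 \<longleftrightarrow> [e = i] (mod n)"
    unfolding power_eq_iff[symmetric] x_def using nonzero by (auto simp: power_inverse field_simps)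
  moreover have "x ^ n = 1"
    using power_n by (simp add: x_def power_mult_distrib power_mult[symmetric] mult.commute[of _ n] power_mult power_inverse)
  ultimately show ?thesis
    by (simp add: sum_gp_strict)
qed

end

lemma primitive_root_of_unity_cis:
  assumes "n > 1"
  shows "primitive_root_of_unity n (cis (2 * pi / real n))"
proof
  fix i
  let ?w = "cis (2 * pi / real n)"
  have pow: "?w ^ k = cis (2 * pi * real k / real n)" for k
    by (simp add: DeMoivre field_simps)
  have "?w ^ n = 1" using assms by (simp add: pow)
  then have "?w ^ (n * (i div n) + i mod n) = ?w ^ (i mod n)"
    unfolding power_add power_mult by simp
  then have "?w ^ i = 1 \<longleftrightarrow> ?w ^ (i mod n) = ?w ^ 0" by simp
  also have "\<dots> \<longleftrightarrow> i mod n = 0"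
    unfolding pow
    using bij_betw_imp_inj_on[OF bij_betw_roots_unity[of n]] assms
    by (subst inj_on_eq_iff[of "\<lambda>k. cis (2 * pi * real k / real n)" "{..<n}"]) auto
  finally show "?w ^ i = 1 \<longleftrightarrow> n dvd i" by (simp add: dvd_eq_mod_eq_0)
qed (rule assms)

section \<open>Characters and Fourier inversion on a finite cyclic group\<close>

locale finite_cyclic_group = group G + primitive_root_of_unity n w
  for G :: "('a, 'b) monoid_scheme" (structure) and n w +
  fixes a
  assumes gen_carrier: "a \<in> carrier G" and gen: "carrier G = generate G {a}"
    and order_eq: "Coset.order G = n"
begin

lemma finite_carrier: "finite (carrier G)"
  using order_eq n_pos by (metis order_gt_0_iff_finite)

lemma carrier_eq_powers: "carrier G = range (\<lambda>i::nat. a [^] i)"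
  using gen generate_pow_on_finite_carrier[OF finite_carrier gen_carrier] by auto

lemma ord_gen: "ord a = n"
  using generate_pow_card[OF gen_carrier] gen order_eq unfolding Coset.order_def by simp

lemma gen_power_eq_iff: "a [^] (i::nat) = a [^] (j::nat) \<longleftrightarrow> [i = j] (mod n)"
proof -
  have *: "a [^] i = a [^] j \<longleftrightarrow> [i = j] (mod n)" if "i \<le> j" for i j :: nat
  proof -
    have "a [^] j = a [^] i \<otimes> a [^] (j - i)"
      using that gen_carrier by (simp add: nat_pow_mult)
    then have "a [^] i = a [^] j \<longleftrightarrow> a [^] (j - i) = \<one>"
      using gen_carrier by (metis l_cancel_one' nat_pow_closed)
    also have "\<dots> \<longleftrightarrow> [j = i] (mod n)"
      using that gen_carrier by (simp add: pow_eq_id ord_gen cong_altdef_nat)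
    finally show ?thesis by (simp add: cong_sym_eq)
  qed
  show ?thesis using *[of i j] *[of j i] by (metis cong_sym_eq nat_le_linear)
qed

text \<open>The discrete logarithm to base \<open>a\<close>. The choice is arbitrary, so only its
  class modulo \<open>n\<close> has a meaning.\<close>

definition expo :: "'a \<Rightarrow> nat" where
  "expo g = (SOME i. g = a [^] i)"

lemma gen_power_expo: "g \<in> carrier G \<Longrightarrow> a [^] expo g = g"
  unfolding expo_def carrier_eq_powers by (metis (mono_tags, lifting) imageE someI_ex)

lemma expo_power: "[expo (a [^] i) = i] (mod n)"
  using gen_power_expo[of "a [^] i"] gen_carrier by (simp add: gen_power_eq_iff)

definition chi :: "nat \<Rightarrow> 'a \<Rightarrow> complex" where
  "chi j g = w ^ (j * expo g)"

lemma chi_power: "chi j (a [^] i) = w ^ (j * i)"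
  unfolding chi_def power_eq_iff using expo_power by (rule cong_scalar_left)

lemma chi_mult:
  assumes "g \<in> carrier G" "h \<in> carrier G"
  shows "chi j (g \<otimes> h) = chi j g * chi j h"
proof -
  obtain i k :: nat where "g = a [^] i" "h = a [^] k" using assms carrier_eq_powers by auto
  then show ?thesis using gen_carrier
    by (simp add: nat_pow_mult chi_power power_add distrib_left)
qed

lemma chi_nonzero: "chi j g \<noteq> 0"
  using nonzero by (simp add: chi_def)

lemma fourier_inversion:
  assumes "g \<in> carrier G"
  shows "(\<Sum>j<n. (\<Sum>h\<in>carrier G. f h * chi j h) * inverse w ^ (j * expo g)) = of_nat n * f g"
proof -
  have "(\<Sum>j<n. (\<Sum>h\<in>carrier G. f h * chi j h) * inverse w ^ (j * expo g))
    = (\<Sum>h\<in>carrier G. f h * (\<Sum>j<n. w ^ (j * expo h) * inverse w ^ (j * expo g)))"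
    unfolding sum_distrib_right sum_distrib_left chi_def
    by (subst sum.swap) (simp add: mult.assoc)
  also have "\<dots> = (\<Sum>h\<in>carrier G. if h = g then of_nat n * f h else 0)"
  proof (intro sum.cong refl)
    fix h assume "h \<in> carrier G"
    then have "[expo h = expo g] (mod n) \<longleftrightarrow> h = g"
      using assms by (metis gen_power_eq_iff gen_power_expo)
    then show "f h * (\<Sum>j<n. w ^ (j * expo h) * inverse w ^ (j * expo g)) = (if h = g then of_nat n * f h else 0)"
      unfolding power_orthogonality by simp
  qed
  also have "\<dots> = of_nat n * f g" using assms finite_carrier by simp
  finally show ?thesis .
qed

text \<open>The sums are the Fourier coefficients of the indicator functions, which inversion
  recovers.\<close>

lemma character_sums_determine_subset:
  assumes "S \<subseteq> carrier G" "T \<subseteq> carrier G"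
    and eq: "\<And>j. j < n \<Longrightarrow> (\<Sum>g\<in>S. chi j g) = (\<Sum>g\<in>T. chi j g)"
  shows "S = T"
proof -
  have ind: "(\<Sum>g\<in>Y. chi j g) = (\<Sum>h\<in>carrier G. of_bool (h \<in> Y) * chi j h)" if "Y \<subseteq> carrier G" for Y j
    using that finite_carrier by (intro sum.mono_neutral_cong_left) auto
  have "of_nat n * of_bool (g \<in> S) = (of_nat n * of_bool (g \<in> T) :: complex)" if "g \<in> carrier G" for g
  proof -
    have "(\<Sum>j<n. (\<Sum>h\<in>carrier G. of_bool (h \<in> S) * chi j h) * inverse w ^ (j * expo g))
      = (\<Sum>j<n. (\<Sum>h\<in>carrier G. of_bool (h \<in> T) * chi j h) * inverse w ^ (j * expo g))"
      by (intro sum.cong refl) (simp only: ind[OF assms(1), symmetric] ind[OF assms(2), symmetric] eq lessThan_iff)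
    then show ?thesis
      using fourier_inversion[OF that, of "\<lambda>h. of_bool (h \<in> S)"]
        fourier_inversion[OF that, of "\<lambda>h. of_bool (h \<in> T)"] by simp
  qed
  then have "g \<in> S \<longleftrightarrow> g \<in> T" if "g \<in> carrier G" for g
    using that n_pos by (fastforce split: if_splits)
  then show ?thesis using assms by blast
qed

text \<open>Characters are eigenfunctions by multiplicativity. Conversely, an eigenfunction has a
  nonzero Fourier coefficient, and the eigenvalue equation multiplies this coefficient by the
  matching character sum.\<close>

lemma Cay_eigenvalues:
  assumes S: "S \<subseteq> carrier G"
  shows "graph_eigenvalues (Cay G S) = (\<lambda>j. \<Sum>s\<in>S. chi j s) ` {..<n}"
proof (intro equalityI subsetI)
  fix x assume "x \<in> (\<lambda>j. \<Sum>s\<in>S. chi j s) ` {..<n}"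
  then obtain j where x: "x = (\<Sum>s\<in>S. chi j s)" by blast
  have "(\<Sum>s\<in>S. chi j (s \<otimes> g)) = x * chi j g" if "g \<in> carrier G" for g
    unfolding x sum_distrib_right using that S by (intro sum.cong) (auto simp: chi_mult)
  then show "x \<in> graph_eigenvalues (Cay G S)"
    unfolding Cay_eigenvalues_iff[OF finite_carrier S]
    using chi_nonzero one_closed by (intro CollectI exI[of _ "chi j"]) blast
next
  fix x assume "x \<in> graph_eigenvalues (Cay G S)"
  then obtain f g0 where g0: "g0 \<in> carrier G" "f g0 \<noteq> 0"
    and f: "\<And>g. g \<in> carrier G \<Longrightarrow> (\<Sum>s\<in>S. f (s \<otimes> g)) = x * f g"
    unfolding Cay_eigenvalues_iff[OF finite_carrier S] by blast
  \<comment> \<open>The inverse in the argument of \<open>f\<close> makes translation by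
    \<open>s\<close> produce the factor \<open>chi j s\<close> itself, not its reciprocal.\<close>
  define F where "F = (\<lambda>j. \<Sum>h\<in>carrier G. f (inv h) * chi j h)"
  have "\<exists>j<n. F j \<noteq> 0"
  proof (rule ccontr)
    assume "\<not> (\<exists>j<n. F j \<noteq> 0)"
    then have "of_nat n * f (inv (inv g0)) = 0"
      using fourier_inversion[of "inv g0" "\<lambda>h. f (inv h)"] g0 by (simp add: F_def)
    then show False using g0 n_pos by simp
  qed
  then obtain j where j: "j < n" "F j \<noteq> 0" by blast
  have "x * F j = (\<Sum>h\<in>carrier G. \<Sum>s\<in>S. f (s \<otimes> inv h) * chi j h)"
    unfolding F_def sum_distrib_left using f by (intro sum.cong refl) (simp add: sum_distrib_right[symmetric])
  also have "\<dots> = (\<Sum>s\<in>S. \<Sum>h\<in>carrier G. f (s \<otimes> inv h) * chi j h)"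
    by (rule sum.swap)
  also have "\<dots> = (\<Sum>s\<in>S. chi j s * F j)"
  proof (rule sum.cong[OF refl])
    fix s assume "s \<in> S"
    then have s: "s \<in> carrier G" using S by blast
    have "(\<Sum>h\<in>carrier G. f (s \<otimes> inv h) * chi j h) = (\<Sum>h\<in>carrier G. f (inv h) * chi j (h \<otimes> s))"
      by (rule sum.reindex_bij_witness[of _ "\<lambda>h. h \<otimes> s" "\<lambda>h. h \<otimes> inv s"])
        (use s in \<open>auto simp: m_assoc inv_mult_group\<close>)
    also have "\<dots> = chi j s * F j"
      unfolding F_def sum_distrib_left using s by (intro sum.cong refl) (simp add: chi_mult)
    finally show "(\<Sum>h\<in>carrier G. f (s \<otimes> inv h) * chi j h) = chi j s * F j" .
  qed
  also have "\<dots> = (\<Sum>s\<in>S. chi j s) * F j" by (simp add: sum_distrib_right)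
  finally have "x = (\<Sum>s\<in>S. chi j s)" using j by simp
  then show "x \<in> (\<lambda>j. \<Sum>s\<in>S. chi j s) ` {..<n}" using j by blast
qed

end

section \<open>Orbits of automorphism groups\<close>

text \<open>The hypothesis on \<open>f\<close> says that its fibres are the right cosets of
  \<open>H\<close>.\<close>

lemma (in group) subgroup_index_eq_card_image:
  assumes H: "subgroup H G"
    and f: "\<And>x y. x \<in> carrier G \<Longrightarrow> y \<in> carrier G \<Longrightarrow> f x = f y \<longleftrightarrow> x \<otimes> inv y \<in> H"
  shows "subgroup_index G H = card (f ` carrier G)"
proof -
  have "f x = f y \<longleftrightarrow> H #> x = H #> y" if xy: "x \<in> carrier G" "y \<in> carrier G" for x y
  proof -
    have "f x = f y \<longleftrightarrow> x \<in> H #> y"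
      using f[OF xy] subgroup.rcos_module[OF H is_group xy(2,1)] by simp
    also have "\<dots> \<longleftrightarrow> H #> x = H #> y"
      using repr_independence[OF _ xy(2) H] rcos_self[OF xy(1) H] by metis
    finally show ?thesis .
  qed
  then have "card (f ` carrier G) = card ((\<lambda>x. H #> x) ` carrier G)"
    by (rule card_image_eq_if_same_fibers)
  moreover have "rcosets H = (\<lambda>x. H #> x) ` carrier G"
    by (auto simp: RCOSETS_def)
  ultimately show ?thesis by (simp add: subgroup_index_def)
qed

text \<open>Units modulo \<open>m\<close> lift to units modulo \<open>n\<close>: add to
  \<open>s\<close> the product of \<open>m\<close> with all primes of \<open>n\<close> not dividing
  \<open>s\<close>. Each prime of \<open>n\<close> then divides exactly one of the two
  summands.\<close>

lemma coprime_lift: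
  fixes m n s :: nat
  assumes n: "n > 0" and m: "m dvd n" and s: "coprime s m"
  shows "\<exists>t. [t = s] (mod m) \<and> coprime t n"
proof -
  define Q where "Q = {p \<in> prime_factors n. \<not> p dvd s}"
  define t where "t = s + m * \<Prod>Q"
  have fin: "finite Q" by (simp add: Q_def)
  have "coprime t n"
  proof (rule ccontr)
    assume "\<not> coprime t n"
    then obtain p where p: "Factorial_Ring.prime p" "p dvd t" "p dvd n"
      by (metis coprime_iff_gcd_eq_1 gcd_dvd1 gcd_dvd2 prime_factor_nat dvd_trans)
    show False
    proof (cases "p dvd s")
      case True
      then have "p dvd m * \<Prod>Q" using p(2) by (simp add: t_def dvd_add_right_iff)
      moreover have "\<not> p dvd m" using True s p(1) by (metis coprime_common_divisor not_prime_unit)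
      ultimately have "p dvd \<Prod>Q" using p(1) by (simp add: prime_dvd_mult_iff)
      then obtain q where "q \<in> Q" "p dvd q"
        using prime_dvd_prod_iff[OF fin p(1), of "\<lambda>x. x"] by auto
      then have "p = q" using p(1) by (auto simp: Q_def intro: primes_dvd_imp_eq)
      then show False using True \<open>q \<in> Q\<close> by (simp add: Q_def)
    next
      case False
      then have "p \<in> Q" using p n by (simp add: Q_def in_prime_factors_iff)
      then have "p dvd \<Prod>Q" using dvd_prodI[OF fin, of p "\<lambda>x. x"] by simp
      then have "p dvd s" using p(2) by (simp add: t_def dvd_add_left_iff)
      then show False using False by contradiction
    qed
  qed
  moreover have "[t = s] (mod m)" by (simp add: t_def cong_def)
  ultimately show ?thesis by blast
qed

section \<open>Automorphisms of a cyclic group as power maps\<close>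

context finite_cyclic_group
begin

abbreviation A where "A \<equiv> AutoGroup G"

interpretation A: group A
  by (rule AutoGroup)

text \<open>Restricted to the carrier because the elements of \<open>AutoGroup G\<close> are
  extensional functions.\<close>

definition power_map :: "nat \<Rightarrow> 'a \<Rightarrow> 'a" where
  "power_map s = (\<lambda>g\<in>carrier G. g [^] s)"

lemma commute:
  assumes "g \<in> carrier G" "h \<in> carrier G"
  shows "g \<otimes> h = h \<otimes> g"
proof -
  obtain i j :: nat where "g = a [^] i" "h = a [^] j" using assms carrier_eq_powers by auto
  then show ?thesis using gen_carrier by (simp add: nat_pow_mult add.commute)
qed

lemma generate_powers: "y \<in> carrier G \<Longrightarrow> z \<in> generate G {y} \<longleftrightarrow> (\<exists>t::nat. z = y [^] t)"
  by (subst generate_pow_on_finite_carrier[OF finite_carrier]) auto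

lemma generate_subset: "y \<in> carrier G \<Longrightarrow> generate G {y [^] (t::nat)} \<subseteq> generate G {y}"
  using generate_powers[of y] generate_powers[of "y [^] t"] by (auto simp: nat_pow_pow)

lemma generate_self: "y \<in> generate G {y}"
  by (rule generate.incl) simp

text \<open>An automorphism is determined by the exponent \<open>s\<close> of the image of
  \<open>a\<close>, and a preimage of \<open>a\<close> provides an inverse of \<open>s\<close>
  modulo \<open>n\<close>. Conversely, a coprime exponent can be cancelled, so the power map is
  injective, and finiteness makes it bijective.\<close>

lemma carrier_AutoGroup: "carrier A = power_map ` {s. coprime s n}"
proof (intro equalityI subsetI)
  fix \<sigma> assume "\<sigma> \<in> carrier A"
  then have hom: "\<sigma> \<in> hom G G" and bij: "bij_betw \<sigma> (carrier G) (carrier G)"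
    and ext: "\<sigma> \<in> extensional (carrier G)"
    by (auto simp: AutoGroup_def auto_def Bij_def)
  interpret \<sigma>: group_hom G G \<sigma>
    by unfold_locales (rule hom)
  have "\<sigma> a \<in> carrier G" using gen_carrier by simp
  then obtain s :: nat where s: "\<sigma> a = a [^] s" using carrier_eq_powers by auto
  have pow: "\<sigma> (a [^] i) = a [^] (s * i)" for i :: nat
    using gen_carrier s by (simp add: \<sigma>.hom_nat_pow nat_pow_pow)
  have \<sigma>_eq: "\<sigma> = power_map s"
  proof (rule extensionalityI[OF ext])
    fix g assume "g \<in> carrier G"
    then obtain i :: nat where "g = a [^] i" using carrier_eq_powers by auto
    then show "\<sigma> g = power_map s g"
      using pow gen_carrier by (simp add: power_map_def nat_pow_pow mult.commute)
  qed (simp add: power_map_def)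
  have "a \<in> \<sigma> ` carrier G" using bij gen_carrier by (simp add: bij_betw_def)
  then obtain g where g: "g \<in> carrier G" "a = \<sigma> g" by blast
  then obtain i :: nat where i: "g = a [^] i" using carrier_eq_powers by blast
  have "a [^] (s * i) = \<sigma> g" unfolding i by (rule pow[symmetric])
  also have "\<dots> = a [^] (1 :: nat)" unfolding g(2)[symmetric] using gen_carrier by simp
  finally have "a [^] (s * i) = a [^] (1 :: nat)" .
  then have "[s * i = 1] (mod n)" by (simp only: gen_power_eq_iff)
  then have "coprime s n" by (auto simp: coprime_iff_invertible_nat)
  then show "\<sigma> \<in> power_map ` {s. coprime s n}" using \<sigma>_eq by blast
next
  fix \<sigma> assume "\<sigma> \<in> power_map ` {s. coprime s n}"
  then obtain s where s: "coprime s n" "\<sigma> = power_map s" by blast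
  have "inj_on (power_map s) (carrier G)"
  proof (rule inj_onI)
    fix g h assume gh: "g \<in> carrier G" "h \<in> carrier G" "power_map s g = power_map s h"
    then obtain i j :: nat where ij: "g = a [^] i" "h = a [^] j" using carrier_eq_powers by auto
    then have "[i * s = j * s] (mod n)"
      using gh gen_carrier by (simp add: power_map_def nat_pow_pow gen_power_eq_iff)
    then have "[i = j] (mod n)" using s(1) by (simp add: cong_mult_rcancel_nat)
    then show "g = h" using ij by (simp add: gen_power_eq_iff)
  qed
  moreover have "power_map s ` carrier G \<subseteq> carrier G" by (auto simp: power_map_def)
  ultimately have "bij_betw (power_map s) (carrier G) (carrier G)"
    using finite_carrier by (simp add: bij_betw_def endo_inj_surj)
  moreover have "power_map s \<in> hom G G"
    by (auto simp: hom_def power_map_def intro!: pow_mult_distrib commute)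
  ultimately show "\<sigma> \<in> carrier A"
    by (auto simp: s AutoGroup_def auto_def Bij_def power_map_def)
qed

lemma aut_closed [simp]: "\<sigma> \<in> carrier A \<Longrightarrow> g \<in> carrier G \<Longrightarrow> \<sigma> g \<in> carrier G"
  by (auto simp: carrier_AutoGroup power_map_def)

lemma aut_mult [simp]:
  assumes "\<sigma> \<in> carrier A" "\<rho> \<in> carrier A" "g \<in> carrier G"
  shows "(\<sigma> \<otimes>\<^bsub>A\<^esub> \<rho>) g = \<sigma> (\<rho> g)"
  using assms by (auto simp: AutoGroup_def BijGroup_def auto_def compose_def)

lemma aut_one [simp]: "g \<in> carrier G \<Longrightarrow> \<one>\<^bsub>A\<^esub> g = g"
  by (simp add: AutoGroup_def BijGroup_def)

lemma aut_inv [simp]: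
  assumes "\<sigma> \<in> carrier A" "g \<in> carrier G"
  shows "(inv\<^bsub>A\<^esub> \<sigma>) (\<sigma> g) = g"
  using aut_mult[of "inv\<^bsub>A\<^esub> \<sigma>" \<sigma> g] assms by simp

lemma aut_eq_pow:
  assumes "\<sigma> \<in> carrier A"
  shows "\<exists>s::nat. coprime s n \<and> (\<forall>g\<in>carrier G. \<sigma> g = g [^] s)"
proof -
  obtain s where "coprime s n" "\<sigma> = power_map s" using assms carrier_AutoGroup by auto
  then show ?thesis by (intro exI[of _ s]) (simp add: power_map_def)
qed

lemma aut_pow:
  assumes "\<sigma> \<in> carrier A" "g \<in> carrier G"
  shows "\<sigma> (g [^] (t::nat)) = \<sigma> g [^] t"
proof -
  obtain s :: nat where s: "\<forall>g\<in>carrier G. \<sigma> g = g [^] s"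
    using aut_eq_pow[OF assms(1)] by blast
  have "\<sigma> (g [^] t) = (g [^] t) [^] s"
    using s nat_pow_closed[OF assms(2)] by blast
  also have "\<dots> = g [^] (t * s)" by (rule nat_pow_pow[OF assms(2)])
  also have "t * s = s * t" by (rule mult.commute)
  also have "g [^] (s * t) = (g [^] s) [^] t" by (rule nat_pow_pow[OF assms(2), symmetric])
  also have "g [^] s = \<sigma> g" using s assms(2) by metis
  finally show ?thesis .
qed

lemma aut_commute:
  assumes "\<sigma> \<in> carrier A" "\<rho> \<in> carrier A" "g \<in> carrier G"
  shows "\<sigma> (\<rho> g) = \<rho> (\<sigma> g)"
proof -
  obtain s :: nat where s: "\<forall>g\<in>carrier G. \<sigma> g = g [^] s"
    using aut_eq_pow[OF assms(1)] by blast
  have "\<sigma> (\<rho> g) = \<rho> g [^] s" using s aut_closed[OF assms(2,3)] by blast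
  also have "\<dots> = \<rho> (g [^] s)" by (rule aut_pow[OF assms(2,3), symmetric])
  also have "g [^] s = \<sigma> g" using s assms(3) by metis
  finally show ?thesis .
qed

lemma aut_eqI:
  assumes "\<sigma> \<in> carrier A" "\<rho> \<in> carrier A" "\<sigma> a = \<rho> a"
  shows "\<sigma> = \<rho>"
proof (rule extensionalityI[of _ "carrier G"])
  fix g assume "g \<in> carrier G"
  then obtain i :: nat where "g = a [^] i" using carrier_eq_powers by auto
  then show "\<sigma> g = \<rho> g" using assms gen_carrier by (simp add: aut_pow)
qed (use assms in \<open>simp_all add: AutoGroup_def auto_def Bij_def\<close>)

end

text \<open>The base point \<open>x\<close> is arbitrary here. The hypothesis on \<open>K\<close> is
  the inclusion of \<open>T\<close> in pointwise form, once \<open>T\<close> is known to be the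
  stabilizer of \<open>x\<close>.\<close>

locale aut_orbit = finite_cyclic_group G n w a
  for G :: "('a, 'b) monoid_scheme" (structure) and n w a +
  fixes x K
  assumes x: "x \<in> carrier G" and K: "subgroup K (AutoGroup G)"
    and stabilizer: "\<And>\<sigma>. \<sigma> \<in> carrier (AutoGroup G) \<Longrightarrow> \<sigma> x = x \<Longrightarrow> \<sigma> \<in> K"
begin

interpretation A: group A
  by (rule AutoGroup)

definition orbit :: "'a set" where
  "orbit = (\<lambda>\<sigma>. \<sigma> x) ` K"

lemma K_carrier: "\<sigma> \<in> K \<Longrightarrow> \<sigma> \<in> carrier A"
  by (rule subgroup.mem_carrier[OF K])

lemma orbit_carrier: "orbit \<subseteq> carrier G"
proof
  fix y assume "y \<in> orbit"
  then obtain \<sigma> where "\<sigma> \<in> K" "y = \<sigma> x" unfolding orbit_def by blast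
  then show "y \<in> carrier G" using aut_closed[OF K_carrier x] by simp
qed

text \<open>Equal translates give \<open>\<sigma> x = \<rho> (\<kappa> x)\<close> with
  \<open>\<kappa>\<close> in \<open>K\<close>. As automorphisms commute, the quotient of
  \<open>\<sigma>\<close> and \<open>\<rho>\<close> times the inverse of \<open>\<kappa>\<close>
  fixes \<open>x\<close> and so lies in \<open>K\<close>. For the converse one inclusion suffices,
  since \<open>K\<close> is closed under inverses.\<close>

lemma orbit_translates_eq_iff:
  assumes \<sigma>: "\<sigma> \<in> carrier A" and \<rho>: "\<rho> \<in> carrier A"
  shows "\<sigma> ` orbit = \<rho> ` orbit \<longleftrightarrow> \<sigma> \<otimes>\<^bsub>A\<^esub> inv\<^bsub>A\<^esub> \<rho> \<in> K"
proof
  assume "\<sigma> ` orbit = \<rho> ` orbit"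
  moreover have "x \<in> orbit"
    unfolding orbit_def
    by (rule image_eqI[where f = "\<lambda>\<sigma>. \<sigma> x", OF _ subgroup.one_closed[OF K]]) (simp add: aut_one x)
  then have "\<sigma> x \<in> \<sigma> ` orbit" by (rule imageI)
  ultimately obtain \<kappa> where \<kappa>: "\<kappa> \<in> K" "\<sigma> x = \<rho> (\<kappa> x)" unfolding orbit_def by blast
  have c: "\<kappa> \<in> carrier A" "inv\<^bsub>A\<^esub> \<kappa> \<in> carrier A" "inv\<^bsub>A\<^esub> \<rho> \<in> carrier A"
    using \<kappa> \<rho> K_carrier by auto
  have "(inv\<^bsub>A\<^esub> \<kappa> \<otimes>\<^bsub>A\<^esub> (\<sigma> \<otimes>\<^bsub>A\<^esub> inv\<^bsub>A\<^esub> \<rho>)) x = (inv\<^bsub>A\<^esub> \<kappa>) (\<sigma> ((inv\<^bsub>A\<^esub> \<rho>) x))"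
    using c \<sigma> \<rho> x by simp
  also have "\<sigma> ((inv\<^bsub>A\<^esub> \<rho>) x) = (inv\<^bsub>A\<^esub> \<rho>) (\<rho> (\<kappa> x))"
    using aut_commute[OF \<sigma> c(3) x] \<kappa>(2) by simp
  also have "(inv\<^bsub>A\<^esub> \<kappa>) \<dots> = x" using c \<rho> x by simp
  finally have "inv\<^bsub>A\<^esub> \<kappa> \<otimes>\<^bsub>A\<^esub> (\<sigma> \<otimes>\<^bsub>A\<^esub> inv\<^bsub>A\<^esub> \<rho>) \<in> K"
    using c \<sigma> by (intro stabilizer) auto
  then have "\<kappa> \<otimes>\<^bsub>A\<^esub> (inv\<^bsub>A\<^esub> \<kappa> \<otimes>\<^bsub>A\<^esub> (\<sigma> \<otimes>\<^bsub>A\<^esub> inv\<^bsub>A\<^esub> \<rho>)) \<in> K"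
    using \<kappa>(1) by (rule subgroup.m_closed[OF K, rotated])
  then show "\<sigma> \<otimes>\<^bsub>A\<^esub> inv\<^bsub>A\<^esub> \<rho> \<in> K"
    using c \<sigma> by (simp add: A.m_assoc[symmetric])
next
  have sub: "\<sigma> ` orbit \<subseteq> \<rho> ` orbit"
    if \<sigma>: "\<sigma> \<in> carrier A" and \<rho>: "\<rho> \<in> carrier A" and mem: "\<sigma> \<otimes>\<^bsub>A\<^esub> inv\<^bsub>A\<^esub> \<rho> \<in> K" for \<sigma> \<rho>
  proof
    fix y assume "y \<in> \<sigma> ` orbit"
    then obtain \<kappa> where \<kappa>: "\<kappa> \<in> K" "y = \<sigma> (\<kappa> x)" unfolding orbit_def by blast
    have c: "\<kappa> \<in> carrier A" "inv\<^bsub>A\<^esub> \<rho> \<in> carrier A" using \<kappa> \<rho> K_carrier by auto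
    have "\<rho> (((\<sigma> \<otimes>\<^bsub>A\<^esub> inv\<^bsub>A\<^esub> \<rho>) \<otimes>\<^bsub>A\<^esub> \<kappa>) x) = \<rho> (\<sigma> ((inv\<^bsub>A\<^esub> \<rho>) (\<kappa> x)))"
      using c \<sigma> \<rho> x by simp
    also have "\<dots> = \<sigma> (\<rho> ((inv\<^bsub>A\<^esub> \<rho>) (\<kappa> x)))"
      using c \<sigma> \<rho> x by (intro aut_commute) auto
    also have "\<rho> ((inv\<^bsub>A\<^esub> \<rho>) (\<kappa> x)) = \<kappa> x"
      using aut_commute[OF \<rho> c(2), of "\<kappa> x"] c \<rho> x by simp
    finally have "y = \<rho> (((\<sigma> \<otimes>\<^bsub>A\<^esub> inv\<^bsub>A\<^esub> \<rho>) \<otimes>\<^bsub>A\<^esub> \<kappa>) x)" using \<kappa> by simp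
    then show "y \<in> \<rho> ` orbit"
      unfolding orbit_def using subgroup.m_closed[OF K mem \<kappa>(1)] by blast
  qed
  assume mem: "\<sigma> \<otimes>\<^bsub>A\<^esub> inv\<^bsub>A\<^esub> \<rho> \<in> K"
  then have "inv\<^bsub>A\<^esub> (\<sigma> \<otimes>\<^bsub>A\<^esub> inv\<^bsub>A\<^esub> \<rho>) \<in> K" by (rule subgroup.m_inv_closed[OF K])
  then have "\<rho> \<otimes>\<^bsub>A\<^esub> inv\<^bsub>A\<^esub> \<sigma> \<in> K" using \<sigma> \<rho> by (simp add: A.inv_mult_group)
  then show "\<sigma> ` orbit = \<rho> ` orbit"
    using sub[OF \<sigma> \<rho> mem] sub[OF \<rho> \<sigma>] by blast
qed

text \<open>The conjugates of the eigenvalues of the Cayley graph: \<open>period j 1\<close> is the sum of the \<open>j\<close>-th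
  character over the orbit.\<close>

definition period :: "nat \<Rightarrow> nat \<Rightarrow> complex" where
  "period j s = (\<Sum>g\<in>orbit. w ^ (j * expo g * s))"

lemma period_1: "period j 1 = (\<Sum>g\<in>orbit. chi j g)"
  by (simp add: period_def chi_def)

lemma int_family_period: "int_family (period j)"
  unfolding period_def by (intro int_family_sum int_family_power)

lemma period_eq_character_sum:
  assumes s: "coprime s n"
  shows "period j s = (\<Sum>g\<in>power_map s ` orbit. chi j g)"
proof -
  have "power_map s \<in> carrier A" using s by (auto simp: carrier_AutoGroup)
  then have "inj_on (power_map s) (carrier G)"
    by (simp add: AutoGroup_def auto_def Bij_def bij_betw_def)
  then have "inj_on (power_map s) orbit" using orbit_carrier by (rule inj_on_subset)
  then have "(\<Sum>g\<in>power_map s ` orbit. chi j g) = (\<Sum>g\<in>orbit. chi j (power_map s g))"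
    by (simp add: sum.reindex)
  also have "\<dots> = period j s"
    unfolding period_def
  proof (rule sum.cong[OF refl])
    fix g assume "g \<in> orbit"
    then have g: "g \<in> carrier G" using orbit_carrier by blast
    then have "power_map s g = a [^] (expo g * s)"
      using gen_power_expo[OF g] nat_pow_pow[OF gen_carrier, of "expo g" s]
      by (simp add: power_map_def)
    then show "chi j (power_map s g) = w ^ (j * expo g * s)"
      by (simp add: chi_power mult.assoc)
  qed
  finally show ?thesis ..
qed

lemma period_eq_iff:
  assumes s: "coprime s n" and t: "coprime t n"
  shows "(\<forall>j<n. period j s = period j t) \<longleftrightarrow> power_map s ` orbit = power_map t ` orbit"
proof
  have "power_map s \<in> carrier A" "power_map t \<in> carrier A" using s t by (auto simp: carrier_AutoGroup)
  then have sub: "power_map s ` orbit \<subseteq> carrier G" "power_map t ` orbit \<subseteq> carrier G"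
    using orbit_carrier by auto
  assume eq: "\<forall>j<n. period j s = period j t"
  show "power_map s ` orbit = power_map t ` orbit"
    by (rule character_sums_determine_subset[OF sub])
      (use eq in \<open>simp add: period_eq_character_sum[OF s, symmetric] period_eq_character_sum[OF t, symmetric]\<close>)
qed (simp add: period_eq_character_sum s t)

lemma eigenvalues_orbit: "graph_eigenvalues (Cay G orbit) = (\<lambda>j. period j 1) ` {..<n}"
  unfolding Cay_eigenvalues[OF orbit_carrier] period_1 ..

theorem algebraic_degree_orbit: "algebraic_degree (Cay G orbit) = subgroup_index A K"
proof -
  have "algebraic_degree (Cay G orbit) = card ((\<lambda>s. map (\<lambda>j. period j s) [0..<n]) ` {s. coprime s n})"
    unfolding algebraic_degree_def splitting_field_def eigenvalues_orbit
    by (rule degree_of_family_field[of n period, OF int_family_imp_rat_family[OF int_family_period]])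
  also have "\<dots> = card ((\<lambda>s. power_map s ` orbit) ` {s. coprime s n})"
  proof (rule card_image_eq_if_same_fibers)
    fix s t assume "s \<in> {s. coprime s n}" "t \<in> {s. coprime s n}"
    then show "(map (\<lambda>j. period j s) [0..<n] = map (\<lambda>j. period j t) [0..<n]) = (power_map s ` orbit = power_map t ` orbit)"
      using period_eq_iff[of s t] by (simp only: mem_Collect_eq map_eq_conv set_upt ball_simps Ball_def atLeastLessThan_iff) simp
  qed
  also have "(\<lambda>s. power_map s ` orbit) ` {s. coprime s n} = (\<lambda>\<sigma>. \<sigma> ` orbit) ` carrier A"
    unfolding carrier_AutoGroup image_image ..
  also have "card \<dots> = subgroup_index A K"
    by (rule A.subgroup_index_eq_card_image[where f = "\<lambda>\<sigma>. \<sigma> ` orbit", OF K orbit_translates_eq_iff, symmetric])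
  finally show ?thesis .
qed

text \<open>An integer eigenvalue agrees with a constant family at \<open>s = 1\<close>, hence at
  all conjugates, so all translates of the orbit coincide. Conversely, invariant integer families
  have integer values. Degree 1 alone would leave the step from rational to integral eigenvalues
  open.\<close>

theorem integral_orbit_iff: "integral_graph (Cay G orbit) \<longleftrightarrow> carrier A = K"
proof
  assume "integral_graph (Cay G orbit)"
  then have int: "period j 1 \<in> \<int>" if "j < n" for j
    using that unfolding integral_graph_def eigenvalues_orbit by blast
  have const: "period j s = period j 1" if "j < n" "coprime s n" for j s
  proof -
    have "rat_family (\<lambda>s. period j 1)"
      using int[OF that(1)] Ints_subset_Rats by (intro rat_family_const) blast
    with int_family_imp_rat_family[OF int_family_period] show ?thesis
      by (rule rat_family_eq[of "period j" "\<lambda>s. period j 1" 1 s]) (simp_all add: that(2))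
  qed
  have eq: "power_map s ` orbit = power_map 1 ` orbit" if "coprime s n" for s
    by (rule period_eq_iff[OF that coprime_1_left, THEN iffD1]) (intro allI impI const that)
  have mem: "power_map s \<in> carrier A" if "coprime s n" for s
    unfolding carrier_AutoGroup using that by blast
  have one: "power_map 1 = \<one>\<^bsub>A\<^esub>"
    by (rule aut_eqI[OF mem[OF coprime_1_left] A.one_closed])
      (simp add: power_map_def gen_carrier aut_one)
  have "\<sigma> \<in> K" if "\<sigma> \<in> carrier A" for \<sigma>
  proof -
    obtain s where "coprime s n" "\<sigma> = power_map s"
      using \<open>\<sigma> \<in> carrier A\<close> unfolding carrier_AutoGroup by blast
    then have "\<sigma> ` orbit = \<one>\<^bsub>A\<^esub> ` orbit" using eq[of s] one by simp
    then have "\<sigma> \<otimes>\<^bsub>A\<^esub> inv\<^bsub>A\<^esub> \<one>\<^bsub>A\<^esub> \<in> K"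
      by (rule orbit_translates_eq_iff[OF that A.one_closed, THEN iffD1])
    then show ?thesis using that by simp
  qed
  then show "carrier A = K" using K_carrier by blast
next
  assume AK: "carrier A = K"
  have "period j 1 \<in> \<int>" if "j < n" for j
  proof (rule int_family_constant[OF int_family_period])
    fix s assume s: "coprime s n"
    have "power_map s \<in> carrier A" "power_map 1 \<in> carrier A"
      unfolding carrier_AutoGroup using s coprime_1_left by blast+
    then have "power_map s ` orbit = power_map 1 ` orbit"
      by (rule orbit_translates_eq_iff[THEN iffD2])
        (use AK A.m_closed A.inv_closed \<open>power_map s \<in> carrier A\<close> \<open>power_map 1 \<in> carrier A\<close> in simp)
    then show "period j s = period j 1"
      using period_eq_iff[OF s coprime_1_left, THEN iffD2] that by blast
  qed
  then show "integral_graph (Cay G orbit)"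
    unfolding integral_graph_def eigenvalues_orbit by blast
qed

end

text \<open>\<open>m\<close> is the order of \<open>a [^] k\<close>, and \<open>coprime l m\<close>
  expresses that \<open>gcd k n = d\<close> after division by \<open>d\<close>.\<close>

locale cyclic_group_power = finite_cyclic_group G n w a
  for G :: "('a, 'b) monoid_scheme" (structure) and n w a +
  fixes d k m l :: nat
  assumes n_eq: "n = d * m" and k_eq: "k = d * l" and coprime_l_m: "coprime l m" and m_gt_1: "m > 1"
begin

interpretation A: group A
  by (rule AutoGroup)

abbreviation x where "x \<equiv> a [^] k"

lemma d_pos: "d > 0"
  using n_pos n_eq by (cases d) auto

lemma x_carrier: "x \<in> carrier G"
  using gen_carrier by simp

lemma x_power_eq_iff: "x [^] (s::nat) = x [^] (t::nat) \<longleftrightarrow> [s = t] (mod m)"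
proof -
  have pow: "x [^] s = a [^] (d * (l * s))" for s :: nat
    unfolding k_eq using gen_carrier by (simp add: nat_pow_pow mult.assoc)
  have "x [^] s = x [^] t \<longleftrightarrow> [d * (l * s) = d * (l * t)] (mod (d * m))"
    unfolding pow gen_power_eq_iff n_eq ..
  also have "\<dots> \<longleftrightarrow> [l * s = l * t] (mod m)"
    unfolding cong_def mult_mod_right[symmetric] using d_pos by simp
  also have "\<dots> \<longleftrightarrow> [s = t] (mod m)"
    by (rule cong_mult_lcancel_nat[OF coprime_l_m])
  finally show ?thesis .
qed

text \<open>One inclusion holds since \<open>d\<close> divides \<open>k\<close>. For the other, an
  inverse of \<open>l\<close> modulo \<open>m\<close> recovers \<open>a [^] d\<close> from
  \<open>x\<close>.\<close>

lemma generate_x: "generate G {x} = generate G {a [^] d}"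
proof
  have "x = (a [^] d) [^] l" unfolding k_eq using gen_carrier by (simp add: nat_pow_pow)
  then show "generate G {x} \<subseteq> generate G {a [^] d}"
    using generate_subset[of "a [^] d" l] gen_carrier by simp
next
  obtain u where "[l * u = 1] (mod m)"
    using cong_solve_coprime_nat[OF coprime_l_m] by auto
  then have "[d * (l * u) = d * 1] (mod n)"
    unfolding n_eq cong_def mult_mod_right[symmetric] by simp
  then have "[k * u = d] (mod n)" unfolding k_eq mult.assoc by simp
  then have "a [^] (k * u) = a [^] d" by (simp only: gen_power_eq_iff)
  then have "x [^] u = a [^] d" using nat_pow_pow[OF gen_carrier, of k u] by simp
  then show "generate G {a [^] d} \<subseteq> generate G {x}"
    using generate_subset[OF x_carrier, of u] by simp
qed

lemma x_power_if_same_generated: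
  assumes "g \<in> same_generated G (a [^] d)"
  obtains t :: nat where "g = x [^] t"
proof -
  have "g \<in> generate G {x}"
    using assms generate_self[of g] unfolding same_generated_def generate_x by simp
  then obtain t :: nat where "g = x [^] t"
    using generate_powers[OF x_carrier] by blast
  then show ?thesis by (rule that)
qed

lemma aut_x_same_generated:
  assumes \<sigma>: "\<sigma> \<in> carrier A"
  shows "\<sigma> x \<in> same_generated G (a [^] d)"
proof -
  have sub: "generate G {\<rho> g} \<subseteq> generate G {g}" if \<rho>: "\<rho> \<in> carrier A" and g: "g \<in> carrier G" for \<rho> g
  proof -
    obtain s :: nat where "\<rho> g = g [^] s" using aut_eq_pow[OF \<rho>] g by blast
    then show ?thesis using generate_subset[OF g, of s] by simp
  qed
  have "(inv\<^bsub>A\<^esub> \<sigma>) (\<sigma> x) = x" by (rule aut_inv[OF \<sigma> x_carrier])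
  then have "generate G {\<sigma> x} = generate G {x}"
    using sub[OF \<sigma> x_carrier] sub[OF A.inv_closed[OF \<sigma>] aut_closed[OF \<sigma> x_carrier]] by simp
  then show ?thesis
    using aut_closed[OF \<sigma> x_carrier] by (simp add: same_generated_def generate_x)
qed

text \<open>The automorphism group is transitive on the generators of each subgroup. A generator is
  a power of \<open>x\<close> whose exponent is only known to be coprime to \<open>m\<close>, and
  lifting it to an exponent coprime to \<open>n\<close> yields the automorphism.\<close>

lemma same_generated_eq_orbit: "same_generated G (a [^] d) = (\<lambda>\<sigma>. \<sigma> x) ` carrier A"
proof (intro equalityI subsetI)
  fix g assume g: "g \<in> same_generated G (a [^] d)"
  then obtain t :: nat where t: "g = x [^] t" by (rule x_power_if_same_generated)
  have gc: "g \<in> carrier G" using g by (simp add: same_generated_def)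
  have "x \<in> generate G {g}"
    using g generate_self[of x] unfolding same_generated_def generate_x by simp
  then obtain u :: nat where "x = g [^] u" using generate_powers[OF gc] by blast
  then have "x [^] (1::nat) = x [^] (t * u)"
    unfolding t nat_pow_pow[OF x_carrier, symmetric] using x_carrier by simp
  then have "[t * u = Suc 0] (mod m)" unfolding x_power_eq_iff using cong_sym by simp
  then have "coprime t m" by (auto simp: coprime_iff_invertible_nat)
  then obtain s where s: "[s = t] (mod m)" "coprime s n"
    using coprime_lift[OF n_pos, of m t] n_eq by auto
  have "power_map s x = x [^] s" using x_carrier by (simp add: power_map_def)
  also have "\<dots> = g" unfolding t x_power_eq_iff by (rule s(1))
  finally have "g = power_map s x" by (rule sym)
  moreover have "power_map s \<in> carrier A" unfolding carrier_AutoGroup using s(2) by blast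
  ultimately show "g \<in> (\<lambda>\<sigma>. \<sigma> x) ` carrier A" by blast
next
  fix g assume "g \<in> (\<lambda>\<sigma>. \<sigma> x) ` carrier A"
  then show "g \<in> same_generated G (a [^] d)" using aut_x_same_generated by blast
qed

text \<open>The class of \<open>a [^] d\<close> contains \<open>x\<close> and consists of powers of
  \<open>x\<close>, so fixing \<open>x\<close> fixes it pointwise.\<close>

lemma aut_fixing_eq_stabilizer:
  "aut_fixing G (same_generated G (a [^] d)) = {\<sigma> \<in> carrier A. \<sigma> x = x}"
proof (intro equalityI subsetI)
  fix \<sigma> assume "\<sigma> \<in> aut_fixing G (same_generated G (a [^] d))"
  moreover have "x \<in> same_generated G (a [^] d)"
    using x_carrier generate_x by (simp add: same_generated_def)
  ultimately show "\<sigma> \<in> {\<sigma> \<in> carrier A. \<sigma> x = x}" by (simp add: aut_fixing_def)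
next
  fix \<sigma> assume "\<sigma> \<in> {\<sigma> \<in> carrier A. \<sigma> x = x}"
  then have \<sigma>: "\<sigma> \<in> carrier A" "\<sigma> x = x" by auto
  have "\<sigma> g = g" if g: "g \<in> same_generated G (a [^] d)" for g
  proof -
    obtain t :: nat where t: "g = x [^] t" using g by (rule x_power_if_same_generated)
    show ?thesis unfolding t using aut_pow[OF \<sigma>(1) x_carrier, of t] \<sigma>(2) by simp
  qed
  then show "\<sigma> \<in> aut_fixing G (same_generated G (a [^] d))"
    using \<sigma>(1) by (simp add: aut_fixing_def)
qed

lemma card_orbit_le:
  assumes S: "S \<subseteq> (\<lambda>\<sigma>. \<sigma> x) ` carrier A"
  shows "card S \<le> totient m"
proof -
  have "S \<subseteq> (\<lambda>t. x [^] t) ` totatives m"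
  proof
    fix g assume "g \<in> S"
    then obtain \<sigma> where \<sigma>: "\<sigma> \<in> carrier A" "g = \<sigma> x" using S by blast
    then obtain s :: nat where s: "coprime s n" "g = x [^] s"
      using aut_eq_pow[OF \<sigma>(1)] x_carrier by blast
    have "coprime s m" using s(1) n_eq by simp
    then have cop: "coprime (s mod m) m" using m_gt_1 by (subst coprime_mod_left_iff) auto
    \<comment> \<open>Totatives start at 1, so the residue 0 has to be excluded, which
      \<open>m > 1\<close> does.\<close>
    moreover have "s mod m \<noteq> 0"
    proof
      assume "s mod m = 0"
      then show False using cop m_gt_1 by simp
    qed
    moreover have "s mod m \<le> m" using m_gt_1 by (intro less_imp_le mod_less_divisor) simp
    ultimately have "s mod m \<in> totatives m" by (simp add: totatives_def)
    moreover have "g = x [^] (s mod m)" unfolding s(2) x_power_eq_iff by (simp add: cong_def)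
    ultimately show "g \<in> (\<lambda>t. x [^] t) ` totatives m" by blast
  qed
  then have "card S \<le> card (totatives m)"
    by (meson card_image_le card_mono finite_imageI finite_totatives order_trans)
  then show ?thesis by (simp add: totient_def)
qed

lemma fix_quotient_iff:
  assumes \<sigma>: "\<sigma> \<in> carrier A" and \<rho>: "\<rho> \<in> carrier A"
  shows "\<sigma> x = \<rho> x \<longleftrightarrow> (\<sigma> \<otimes>\<^bsub>A\<^esub> inv\<^bsub>A\<^esub> \<rho>) x = x"
proof -
  have i: "inv\<^bsub>A\<^esub> \<rho> \<in> carrier A" by (rule A.inv_closed[OF \<rho>])
  have eq: "(\<sigma> \<otimes>\<^bsub>A\<^esub> inv\<^bsub>A\<^esub> \<rho>) x = (inv\<^bsub>A\<^esub> \<rho>) (\<sigma> x)"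
    unfolding aut_mult[OF \<sigma> i x_carrier] by (rule aut_commute[OF \<sigma> i x_carrier])
  have "\<rho> ((inv\<^bsub>A\<^esub> \<rho>) (\<sigma> x)) = (inv\<^bsub>A\<^esub> \<rho>) (\<rho> (\<sigma> x))"
    by (rule aut_commute[OF \<rho> i aut_closed[OF \<sigma> x_carrier]])
  also have "\<dots> = \<sigma> x" by (rule aut_inv[OF \<rho> aut_closed[OF \<sigma> x_carrier]])
  finally have cancel: "\<rho> ((inv\<^bsub>A\<^esub> \<rho>) (\<sigma> x)) = \<sigma> x" .
  show ?thesis
  proof
    assume "\<sigma> x = \<rho> x"
    then show "(\<sigma> \<otimes>\<^bsub>A\<^esub> inv\<^bsub>A\<^esub> \<rho>) x = x" unfolding eq using aut_inv[OF \<rho> x_carrier] by simp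
  next
    assume "(\<sigma> \<otimes>\<^bsub>A\<^esub> inv\<^bsub>A\<^esub> \<rho>) x = x"
    then have "(inv\<^bsub>A\<^esub> \<rho>) (\<sigma> x) = x" unfolding eq .
    then show "\<sigma> x = \<rho> x" using cancel by simp
  qed
qed

lemma subgroup_stabilizer: "subgroup {\<sigma> \<in> carrier A. \<sigma> x = x} A"
proof (rule A.subgroupI)
  show "{\<sigma> \<in> carrier A. \<sigma> x = x} \<noteq> {}"
    using A.one_closed aut_one[OF x_carrier] by blast
next
  fix \<sigma> assume "\<sigma> \<in> {\<sigma> \<in> carrier A. \<sigma> x = x}"
  then have \<sigma>: "\<sigma> \<in> carrier A" "\<sigma> x = x" by auto
  have "(inv\<^bsub>A\<^esub> \<sigma>) x = x" using aut_inv[OF \<sigma>(1) x_carrier] unfolding \<sigma>(2) .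
  then show "inv\<^bsub>A\<^esub> \<sigma> \<in> {\<sigma> \<in> carrier A. \<sigma> x = x}" using A.inv_closed[OF \<sigma>(1)] by blast
next
  fix \<sigma> \<rho> assume "\<sigma> \<in> {\<sigma> \<in> carrier A. \<sigma> x = x}" "\<rho> \<in> {\<sigma> \<in> carrier A. \<sigma> x = x}"
  then have \<sigma>: "\<sigma> \<in> carrier A" "\<sigma> x = x" and \<rho>: "\<rho> \<in> carrier A" "\<rho> x = x" by auto
  have "(\<sigma> \<otimes>\<^bsub>A\<^esub> \<rho>) x = x" unfolding aut_mult[OF \<sigma>(1) \<rho>(1) x_carrier] \<rho>(2) by (rule \<sigma>(2))
  then show "\<sigma> \<otimes>\<^bsub>A\<^esub> \<rho> \<in> {\<sigma> \<in> carrier A. \<sigma> x = x}" using A.m_closed[OF \<sigma>(1) \<rho>(1)] by blast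
qed blast

text \<open>The orbit-stabilizer theorem for \<open>K\<close> as a group of its own, where inverses
  agree with those in \<open>A\<close>.\<close>

lemma card_orbit_eq_index:
  assumes K: "subgroup K A" and sub: "{\<sigma> \<in> carrier A. \<sigma> x = x} \<subseteq> K"
  shows "subgroup_index (A\<lparr>carrier := K\<rparr>) {\<sigma> \<in> carrier A. \<sigma> x = x} = card ((\<lambda>\<sigma>. \<sigma> x) ` K)"
proof -
  interpret K: group "A\<lparr>carrier := K\<rparr>"
    by (rule subgroup.subgroup_is_group[OF K AutoGroup])
  have T: "subgroup {\<sigma> \<in> carrier A. \<sigma> x = x} (A\<lparr>carrier := K\<rparr>)"
    by (rule A.subgroup_incl[OF subgroup_stabilizer K sub])
  have "subgroup_index (A\<lparr>carrier := K\<rparr>) {\<sigma> \<in> carrier A. \<sigma> x = x}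
      = card ((\<lambda>\<sigma>. \<sigma> x) ` carrier (A\<lparr>carrier := K\<rparr>))"
  proof (rule K.subgroup_index_eq_card_image[OF T])
    fix \<sigma> \<rho> assume "\<sigma> \<in> carrier (A\<lparr>carrier := K\<rparr>)" "\<rho> \<in> carrier (A\<lparr>carrier := K\<rparr>)"
    then have K': "\<sigma> \<in> K" "\<rho> \<in> K" by auto
    then have c: "\<sigma> \<in> carrier A" "\<rho> \<in> carrier A" using subgroup.mem_carrier[OF K] by auto
    have inv: "inv\<^bsub>A\<lparr>carrier := K\<rparr>\<^esub> \<rho> = inv\<^bsub>A\<^esub> \<rho>"
      by (rule A.m_inv_consistent[OF K K'(2)])
    have "\<sigma> \<otimes>\<^bsub>A\<^esub> inv\<^bsub>A\<^esub> \<rho> \<in> carrier A" using c by (intro A.m_closed A.inv_closed)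
    then show "(\<sigma> x = \<rho> x) = (\<sigma> \<otimes>\<^bsub>A\<lparr>carrier := K\<rparr>\<^esub> inv\<^bsub>A\<lparr>carrier := K\<rparr>\<^esub> \<rho> \<in> {\<sigma> \<in> carrier A. \<sigma> x = x})"
      unfolding inv using fix_quotient_iff[OF c] by simp
  qed
  then show ?thesis by simp
qed

text \<open>The orbit lies in the subgroup generated by \<open>a [^] d\<close>. If that contains
  \<open>a\<close>, then \<open>d\<close> is invertible modulo \<open>n\<close> while dividing it.
  For \<open>d = 1\<close> the element \<open>x\<close> alone generates \<open>G\<close>.\<close>

lemma orbit_generates_iff:
  assumes K: "subgroup K A"
  shows "generate G ((\<lambda>\<sigma>. \<sigma> x) ` K) = carrier G \<longleftrightarrow> d = 1"
proof
  let ?S = "(\<lambda>\<sigma>. \<sigma> x) ` K"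
  have S: "g \<in> same_generated G (a [^] d)" if "g \<in> ?S" for g
    using that aut_x_same_generated subgroup.mem_carrier[OF K] by blast
  {
    assume gen_S: "generate G ?S = carrier G"
    have "?S \<subseteq> generate G {a [^] d}"
    proof
      fix g assume "g \<in> ?S"
      then have "generate G {g} = generate G {a [^] d}" using S by (simp add: same_generated_def)
      then show "g \<in> generate G {a [^] d}" using generate_self[of g] by simp
    qed
    moreover have "subgroup (generate G {a [^] d}) G"
      using gen_carrier by (intro generate_is_subgroup) simp
    ultimately have "generate G ?S \<subseteq> generate G {a [^] d}"
      by (rule generate_subgroup_incl)
    then have "a \<in> generate G {a [^] d}" using gen_S gen_carrier by blast
    then obtain t :: nat where "a = (a [^] d) [^] t"
      using generate_powers[OF nat_pow_closed[OF gen_carrier, of d]] by blast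
    then have "a [^] (1::nat) = a [^] (d * t)"
      using gen_carrier nat_pow_pow[OF gen_carrier, of d t] by (metis nat_pow_eone)
    then have "[d * t = Suc 0] (mod n)" unfolding gen_power_eq_iff using cong_sym by simp
    then have "coprime d n" by (auto simp: coprime_iff_invertible_nat)
    moreover have "d dvd n" unfolding n_eq by simp
    ultimately show "d = 1" by (metis coprime_absorb_left is_unit_gcd nat_dvd_1_iff_1)
  }
  assume d: "d = 1"
  have Sc: "?S \<subseteq> carrier G" using S by (auto simp: same_generated_def)
  have "x \<in> ?S"
    by (rule image_eqI[where f = "\<lambda>\<sigma>. \<sigma> x", OF _ subgroup.one_closed[OF K]])
      (simp add: aut_one x_carrier)
  then have "generate G {x} \<subseteq> generate G ?S" by (intro mono_generate) simp
  moreover have "generate G {x} = carrier G"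
    unfolding generate_x d using gen_carrier gen by simp
  ultimately show "generate G ?S = carrier G"
    using generate_incl[OF Sc] by blast
qed

lemma stabilizer_trivial:
  assumes d: "d = 1"
  shows "{\<sigma> \<in> carrier A. \<sigma> x = x} = {\<one>\<^bsub>A\<^esub>}"
proof (intro equalityI subsetI)
  fix \<sigma> assume "\<sigma> \<in> {\<sigma> \<in> carrier A. \<sigma> x = x}"
  then have \<sigma>: "\<sigma> \<in> carrier A" "\<sigma> x = x" by auto
  have "a \<in> generate G {x}" unfolding generate_x d using gen_carrier gen by simp
  then obtain t :: nat where t: "a = x [^] t" using generate_powers[OF x_carrier] by blast
  have "\<sigma> (x [^] t) = x [^] t" unfolding aut_pow[OF \<sigma>(1) x_carrier] \<sigma>(2) ..
  then have "\<sigma> a = a" unfolding t[symmetric] .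
  then have "\<sigma> a = \<one>\<^bsub>A\<^esub> a" unfolding aut_one[OF gen_carrier] .
  then show "\<sigma> \<in> {\<one>\<^bsub>A\<^esub>}" using aut_eqI[OF \<sigma>(1) A.one_closed] by blast
qed (use aut_one[OF x_carrier] A.one_closed in blast)

text \<open>An automorphism inverting the generator inverts every power of it, and composing with it
  keeps the orbit.\<close>

lemma orbit_inverse_closed:
  assumes K: "subgroup K A" and \<tau>: "\<tau> \<in> K" "\<tau> a = inv a"
  shows "inverse_closed G ((\<lambda>\<sigma>. \<sigma> x) ` K)"
  unfolding inverse_closed_def
proof
  fix g assume "g \<in> (\<lambda>\<sigma>. \<sigma> x) ` K"
  then obtain \<sigma> where \<sigma>: "\<sigma> \<in> K" "g = \<sigma> x" by blast
  have c: "\<sigma> \<in> carrier A" "\<tau> \<in> carrier A" using subgroup.mem_carrier[OF K] \<sigma> \<tau> by auto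
  have "g \<in> carrier G" unfolding \<sigma>(2) by (rule aut_closed[OF c(1) x_carrier])
  then obtain i :: nat where i: "g = a [^] i" using carrier_eq_powers by blast
  have "(\<tau> \<otimes>\<^bsub>A\<^esub> \<sigma>) x = \<tau> g" unfolding \<sigma>(2) by (rule aut_mult[OF c(2,1) x_carrier])
  also have "\<dots> = inv g"
    unfolding i aut_pow[OF c(2) gen_carrier] \<tau>(2) by (rule nat_pow_inv[OF gen_carrier])
  finally have "inv g = (\<tau> \<otimes>\<^bsub>A\<^esub> \<sigma>) x" by (rule sym)
  then show "inv g \<in> (\<lambda>\<sigma>. \<sigma> x) ` K"
    using subgroup.m_closed[OF K \<tau>(1) \<sigma>(1)] by blast
qed

end

theorem proposition4p5:
  fixes G :: "('a, 'b) monoid_scheme" (structure)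
    and a :: 'a and n d k :: nat
    and A :: "('a \<Rightarrow> 'a) monoid" and T K :: "('a \<Rightarrow> 'a) set"
    and S :: "'a set" and \<Gamma> :: "'a pair_pre_digraph"
  assumes "n \<ge> 3" and "d > 0" and "d dvd n" and "d \<noteq> n"
    and "group G" and "a \<in> carrier G" and "carrier G = generate G {a}" and "Coset.order G = n"
    and "A = AutoGroup G"
    and "T = aut_fixing G (same_generated G (a [^] d))"
    and "subgroup K A" and "T \<subseteq> K"
    and "1 \<le> k" and "k \<le> n - 1" and "gcd k n = d"
    and "S = {\<sigma> (a [^] k) |\<sigma>. \<sigma> \<in> K}"
    and "\<Gamma> = Cay G S"
  shows "((\<exists>\<tau>\<in>K. \<tau> a = inv a) \<longrightarrow> inverse_closed G S)
    \<and> (card S = subgroup_index (A\<lparr>carrier := K\<rparr>) T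
        \<and> subgroup_index (A\<lparr>carrier := K\<rparr>) T \<le> totient (n div d))
    \<and> ((generate G S = carrier G \<longleftrightarrow> d = 1) \<and> (d = 1 \<longrightarrow> T = {\<one>\<^bsub>A\<^esub>}))
    \<and> algebraic_degree \<Gamma> dvd subgroup_index A K
    \<and> ((integral_graph \<Gamma> \<longleftrightarrow> carrier A = K)
        \<and> (integral_graph \<Gamma> \<longrightarrow> S = same_generated G (a [^] d)))
    \<and> (\<forall>p. Factorial_Ring.prime p \<and> subgroup_index A K = p \<longrightarrow> k_integral p \<Gamma>)"
proof -
  define w where "w = cis (2 * pi / real n)"
  define m where "m = n div d"
  define l where "l = k div d"
  have n_eq: "n = d * m" using \<open>d dvd n\<close> by (simp add: m_def)
  have "d dvd k" unfolding \<open>gcd k n = d\<close>[symmetric] by simp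
  then have k_eq: "k = d * l" by (simp add: l_def)
  have "coprime l m"
    unfolding l_def m_def \<open>gcd k n = d\<close>[symmetric] using \<open>1 \<le> k\<close> by (intro div_gcd_coprime) simp
  have "m \<noteq> 0" using n_eq \<open>n \<ge> 3\<close> by (cases "m = 0") simp_all
  moreover have "m \<noteq> 1" using n_eq \<open>d \<noteq> n\<close> by (cases "m = 1") simp_all
  ultimately have "m > 1" by simp
  have AG: "A = AutoGroup G" by fact
  have prim: "primitive_root_of_unity n w"
    unfolding w_def using \<open>n \<ge> 3\<close> by (intro primitive_root_of_unity_cis) simp
  have cyc: "finite_cyclic_group G n w a"
    by (intro finite_cyclic_group.intro finite_cyclic_group_axioms.intro prim) fact+
  interpret C: cyclic_group_power G n w a d k m l
    by (intro cyclic_group_power.intro cyc cyclic_group_power_axioms.intro) fact+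
  have S: "S = (\<lambda>\<sigma>. \<sigma> (a [^] k)) ` K" unfolding \<open>S = _\<close> by blast
  have T: "T = {\<sigma> \<in> carrier (AutoGroup G). \<sigma> (a [^] k) = a [^] k}"
    unfolding \<open>T = _\<close> by (rule C.aut_fixing_eq_stabilizer)
  have K: "subgroup K (AutoGroup G)" using \<open>subgroup K A\<close> unfolding AG .
  have KA: "K \<subseteq> carrier (AutoGroup G)" by (rule subgroup.subset[OF K])
  interpret O: aut_orbit G n w a "a [^] k" K
    by (intro aut_orbit.intro cyc aut_orbit_axioms.intro C.x_carrier K)
      (use \<open>T \<subseteq> K\<close> in \<open>unfold T, blast\<close>)
  have \<Gamma>: "\<Gamma> = Cay G O.orbit" unfolding \<open>\<Gamma> = _\<close> S O.orbit_def ..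
  have index: "card S = subgroup_index (A\<lparr>carrier := K\<rparr>) T"
    unfolding S T AG by (rule C.card_orbit_eq_index[OF K, symmetric]) (use \<open>T \<subseteq> K\<close> in \<open>unfold T\<close>)
  have le: "card S \<le> totient (n div d)"
    unfolding m_def[symmetric] by (rule C.card_orbit_le) (use S KA in blast)
  \<comment> \<open>Both the divisibility and the \<open>p\<close>-integrality are read off this
    equality.\<close>
  have degree: "algebraic_degree \<Gamma> = subgroup_index A K"
    unfolding \<Gamma> AG by (rule O.algebraic_degree_orbit)
  have integral: "integral_graph \<Gamma> \<longleftrightarrow> carrier A = K"
    unfolding \<Gamma> AG by (rule O.integral_orbit_iff)
  have "inverse_closed G S" if "\<exists>\<tau>\<in>K. \<tau> a = inv a"
    using that C.orbit_inverse_closed[OF K] unfolding S by blast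
  moreover have "generate G S = carrier G \<longleftrightarrow> d = 1"
    unfolding S by (rule C.orbit_generates_iff[OF K])
  moreover have "T = {\<one>\<^bsub>A\<^esub>}" if "d = 1"
    unfolding T AG by (rule C.stabilizer_trivial[OF that])
  moreover have "S = same_generated G (a [^] d)" if "integral_graph \<Gamma>"
    using that unfolding integral S C.same_generated_eq_orbit AG by simp
  ultimately show ?thesis
    using index le degree integral unfolding k_integral_def by (metis dvd_refl)
qed

end
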